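(* For every real $\alpha<1$, the class \[X_\alpha=\mathrm{SIZE}_{\mathrm{i.o.}}\!\left(\frac{2^n}{n}\left(1+\frac{\alpha\log n}{n}\right)\right)\] has $\mathcal{M}_{\mathrm{NP}}$-measure 0.
   Context: Languages $A\subseteq\{0,1\}^*$ are identified with their characteristic sequences in Cantor space $\mathbf{C}=\{0,1\}^\infty$, using the standard enumeration $s_0=\lambda, s_1=0, s_2=1, s_3=00,\dots$ of $\{0,1\}^*$; for $S\in\mathbf C$, $S\upharpoonright n$ is the length-$n$ prefix of $S$. For a language $A$, $A_{=n}=A\cap\{0,1\}^n$. $\mathrm{SIZE}_{\mathrm{i.o.}}(s(n))$ is the class of languages $B$ such that for infinitely many $n$, $B_{=n}$ is decided by a Boolean circuit with at most $s(n)$ gates. Logarithms are base 2. For a set of strings $A\subseteq\{0,1\}^*$, $A^{\mathrm{i.o.}}=\{S\in\mathbf C : S\upharpoonright n\in A \text{ for infinitely many } n\}$. A series $\sum_n a_n$ of nonnegative reals is p-convergent if there is a polynomial-time computable $m:\mathbb N\to\mathbb N$ (input in unary) with $\sum_{n\ge m(i)}a_n\le 2^{-i}$ for all $i$. For a complexity class $\mathcal C$, a class $X\subseteq\mathbf C$ has $\mathcal{M}_{\mathcal C}$-measure 0 if there exist $A\in\mathcal C$ and a polynomial-time computable $f$ such that (1) $X\subseteq A^{\mathrm{i.o.}}$, (2) $\log|A_{=n}|<n-f(n)$ for all sufficiently large $n$, and (3) $\sum_{n=0}^\infty 2^{-f(n)}$ is p-convergent. *)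

theory Defs
  imports Complex_Main "HOL-Computational_Algebra.Polynomial" "HOL-Library.Infinite_Set"
begin

section \<open>Deterministic multitape Turing machines\<close>

text \<open>
  Tapes are infinite in both directions and carry the symbols 0, 1 and blank (\<open>None\<close>).
  The control states are the numbers below \<open>num_states\<close>, with initial state 0; the machine halts
  as soon as it reaches any other number. The transition function sees the state and the list of
  the \<open>num_tapes\<close> scanned symbols, and yields the next state and for each tape the symbol to be
  written and the head movement. Only finitely many arguments of it are ever relevant, so every
  record of this type is a Turing machine.
\<close>

type_synonym symbol = "bool option"

datatype move = Left | Stay | Right

fun offset :: "move \<Rightarrow> int" where
  "offset Left = -1"
| "offset Stay = 0"
| "offset Right = 1"

record turing_machine =
  num_tapes :: nat
  num_states :: nat
  transition :: "nat \<Rightarrow> symbol list \<Rightarrow> nat \<times> (nat \<Rightarrow> symbol \<times> move)"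

type_synonym tape = "(int \<Rightarrow> symbol) \<times> int"
type_synonym config = "nat \<times> (nat \<Rightarrow> tape)"

definition scanned :: "tape \<Rightarrow> symbol" where
  "scanned = (\<lambda>(c, h). c h)"

definition act :: "symbol \<times> move \<Rightarrow> tape \<Rightarrow> tape" where
  "act = (\<lambda>(s, d) (c, h). (c(h := s), h + offset d))"

definition step :: "turing_machine \<Rightarrow> config \<Rightarrow> config" where
  "step M = (\<lambda>(q, T).
     if q < num_states M
     then (let (q', a) = transition M q (map (\<lambda>i. scanned (T i)) [0..<num_tapes M])
           in (q', \<lambda>i. if i < num_tapes M then act (a i) (T i) else T i))
     else (q, T))"

definition word_cells :: "bool list \<Rightarrow> int \<Rightarrow> symbol" where
  "word_cells w = (\<lambda>p. if 0 \<le> p \<and> p < int (length w) then Some (w ! nat p) else None)"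

text \<open>Tape 0 is the output tape; the input words are on the tapes 1, 2, \<open>\<dots>\<close>\<close>

definition initial :: "bool list list \<Rightarrow> config" where
  "initial ws = (0, \<lambda>i. (if 1 \<le> i \<and> i \<le> length ws then word_cells (ws ! (i - 1)) else (\<lambda>_. None), 0))"

text \<open>The output is the word from cell 0 up to the first blank. Halted configurations are fixed
  points of \<^const>\<open>step\<close>, so \<open>t\<close> is an upper bound on the running time.\<close>

definition computes_within :: "turing_machine \<Rightarrow> bool list list \<Rightarrow> nat \<Rightarrow> bool list \<Rightarrow> bool" where
  "computes_within M ws t v \<longleftrightarrow>
     (let (q, T) = (step M ^^ t) (initial ws)
      in num_states M \<le> q \<and>
         (\<forall>j\<le>length v. fst (T 0) (int j) = (if j < length v then Some (v ! j) else None)))"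

section \<open>Polynomial time and NP\<close>

definition polytime :: "('a \<Rightarrow> bool list list) \<Rightarrow> ('a \<Rightarrow> bool list) \<Rightarrow> bool" where
  "polytime inp out \<longleftrightarrow>
     (\<exists>M (p :: nat poly). \<forall>a. computes_within M (inp a) (poly p (sum_list (map length (inp a)))) (out a))"

fun binary :: "nat \<Rightarrow> bool list" where
  "binary n = (if n < 2 then [n = 1] else binary (n div 2) @ [odd n])"

declare binary.simps [simp del]

text \<open>Arguments are given in unary, values are output in binary, most significant bit first.\<close>

definition polytime_nat :: "(nat \<Rightarrow> nat) \<Rightarrow> bool" where
  "polytime_nat f \<longleftrightarrow> polytime (\<lambda>n. [replicate n False]) (\<lambda>n. binary (f n))"

type_synonym language = "bool list set"

definition NP :: "language set" where
  "NP = {A. \<exists>(V :: bool list \<Rightarrow> bool list \<Rightarrow> bool) (p :: nat poly).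
              polytime (\<lambda>(x, y). [x, y]) (\<lambda>(x, y). [V x y]) \<and>
              (\<forall>x. x \<in> A \<longleftrightarrow> (\<exists>y. length y \<le> poly p (length x) \<and> V x y))}"

section \<open>Cantor space\<close>

fun std_enum :: "nat \<Rightarrow> bool list" where
  "std_enum 0 = []"
| "std_enum (Suc n) = std_enum (n div 2) @ [odd n]"

lemma std_enum_strict_mono:
  "m < n \<Longrightarrow> (std_enum m, std_enum n) \<in> lenlex {(False, True)}"
proof (induction n arbitrary: m rule: less_induct)
  case (less n)
  then obtain n' where n: "n = Suc n'" by (cases n) auto
  show ?case
  proof (cases m)
    case 0
    then show ?thesis by (simp add: n lenlex_conv)
  next
    case (Suc m')
    with less.prems n have lt: "m' < n'" by simp
    show ?thesis
    proof (cases "m' div 2 = n' div 2")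
      case True
      with lt have "even m'" "odd n'" by presburger+
      with True show ?thesis
        by (simp add: Suc n lenlex_conv lex_append_leftI)
    next
      case False
      with lt have "m' div 2 < n' div 2" by (simp add: div_le_mono le_neq_implies_less)
      with less.IH[of "n' div 2" "m' div 2"] n
      have "(std_enum (m' div 2), std_enum (n' div 2)) \<in> lenlex {(False, True)}" by simp
      then show ?thesis by (simp add: Suc n lenlex_append1)
    qed
  qed
qed

lemma bij_std_enum: "bij std_enum"
proof (rule bijI)
  show "inj std_enum"
  proof (rule linorder_injI)
    fix m n :: nat
    assume "m < n"
    then have "(std_enum m, std_enum n) \<in> lenlex {(False, True)}" by (rule std_enum_strict_mono)
    moreover have "(w, w) \<notin> lenlex {(False, True)}" for w
      by (rule lenlex_irreflexive) simp
    ultimately show "std_enum m \<noteq> std_enum n" by metis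
  qed
  have "\<exists>n. std_enum n = w" for w
  proof (induction w rule: rev_induct)
    case Nil
    show ?case by (rule exI[of _ 0]) simp
  next
    case (snoc b w)
    then obtain n where "std_enum n = w" by blast
    then show ?case by (intro exI[of _ "Suc (2 * n + (if b then 1 else 0))"]) simp
  qed
  then show "surj std_enum" unfolding surj_def by metis
qed

definition char_seq :: "language \<Rightarrow> nat \<Rightarrow> bool" where
  "char_seq A = (\<lambda>n. std_enum n \<in> A)"

definition seq_prefix :: "(nat \<Rightarrow> bool) \<Rightarrow> nat \<Rightarrow> bool list" where
  "seq_prefix S n = map S [0..<n]"

definition infinitely_often :: "bool list set \<Rightarrow> (nat \<Rightarrow> bool) set" where
  "infinitely_often A = {S. \<exists>\<^sub>\<infinity>n. seq_prefix S n \<in> A}"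

definition slice :: "bool list set \<Rightarrow> nat \<Rightarrow> bool list set" where
  "slice A n = {w \<in> A. length w = n}"

section \<open>Measure zero\<close>

definition p_convergent :: "(nat \<Rightarrow> real) \<Rightarrow> bool" where
  "p_convergent a \<longleftrightarrow>
     (\<forall>n. 0 \<le> a n) \<and> summable a \<and>
     (\<exists>m. polytime_nat m \<and> (\<forall>i. (\<Sum>n. a (n + m i)) \<le> 1 / 2 ^ i))"

text \<open>The case distinction on \<open>slice A n\<close> implements the convention that the logarithm of 0 is
  minus infinity.\<close>

definition M_measure_zero :: "language set \<Rightarrow> (nat \<Rightarrow> bool) set \<Rightarrow> bool" where
  "M_measure_zero \<C> X \<longleftrightarrow>
     (\<exists>A\<in>\<C>. \<exists>f. polytime_nat f \<and>
        X \<subseteq> infinitely_often A \<and>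
        (\<forall>\<^sub>F n in sequentially.
           slice A n = {} \<or> log 2 (real (card (slice A n))) < real n - real (f n)) \<and>
        p_convergent (\<lambda>n. 2 powr (- real (f n))))"

section \<open>Boolean circuits\<close>

text \<open>
  Circuits have fan-in two gates computing arbitrary binary Boolean functions, listed in a
  topological order. Wires \<open>0, \<dots>, n - 1\<close> are the inputs, which are not counted as gates, and wire
  \<open>n + i\<close> is the output of gate \<open>i\<close>. The second component is the output wire of the circuit.
\<close>

type_synonym gate = "(bool \<Rightarrow> bool \<Rightarrow> bool) \<times> nat \<times> nat"
type_synonym circuit = "gate list \<times> nat"

definition is_circuit :: "nat \<Rightarrow> circuit \<Rightarrow> bool" where
  "is_circuit n = (\<lambda>(gs, out).
     (\<forall>i<length gs. case gs ! i of (g, a, b) \<Rightarrow> a < n + i \<and> b < n + i) \<and> out < n + length gs)"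

definition num_gates :: "circuit \<Rightarrow> nat" where
  "num_gates C = length (fst C)"

definition circuit_value :: "circuit \<Rightarrow> bool list \<Rightarrow> bool" where
  "circuit_value = (\<lambda>(gs, out) x.
     foldl (\<lambda>vs (g, a, b). vs @ [g (vs ! a) (vs ! b)]) x gs ! out)"

definition SIZE_io :: "(nat \<Rightarrow> real) \<Rightarrow> language set" where
  "SIZE_io s = {B. \<exists>\<^sub>\<infinity>n. \<exists>C. is_circuit n C \<and> real (num_gates C) \<le> s n \<and>
                     (\<forall>x. length x = n \<longrightarrow> (circuit_value C x \<longleftrightarrow> x \<in> slice B n))}"

end

theory Submission
  imports Defs "HOL-Library.Cardinality"
begin

text \<open>
  One set \<open>A\<close> in NP works for all \<open>\<alpha> < 1\<close>: the strings of length \<open>2\<^bsup>n+1\<^esup> - 1\<close> whose last \<open>2\<^sup>n\<close> bits are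
  the truth table of a circuit with \<open>k\<close> gates, where \<open>log k! + O(k) \<le> 2\<^sup>n\<close>. Since \<open>k log k + O(k)\<close> is
  \<open>2\<^sup>n (1 - (1 - \<alpha>) log n / n + O(1/n))\<close> for \<open>k = 2\<^sup>n/n (1 + \<alpha> log n / n)\<close>, every circuit of the size in
  question qualifies for large \<open>n\<close>. Conversely, the functions computed at the gates of a circuit
  can be numbered in \<open>k!\<close> ways with different descriptions, so there are at most
  \<open>(16 (n + 1 + k)\<^sup>2)\<^sup>k / k! = k! 2\<^bsup>O(k+n)\<^esup>\<close> such sets of functions, and a large enough constant in the
  size restriction leaves \<open>A\<close> with at most \<open>2\<^bsup>N - 4(n+1)\<^esup>\<close> strings of length \<open>N = 2\<^bsup>n+1\<^esup> - 1\<close>. This is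
  below \<open>2\<^bsup>N - f(N)\<^esup>\<close> for \<open>f(N) = 2 \<lfloor>log (N+1)\<rfloor> + 2\<close>.
\<close>

section \<open>A stack language and its compilation to Turing machines\<close>

text \<open>Why \<open>k!\<close> matters: listing the gates takes about \<open>2 k log k\<close>
  bits, which is close to \<open>2 * 2^n\<close> at the sizes in question and thus useless against
  truth tables of \<open>2^n\<close> bits; dividing by \<open>k!\<close> halves this. Renumbering
  the gates of a circuit does not give this factor directly, since swapping two gates that compute
  the same function may leave the description unchanged. Sets of functions avoid this: their
  elements are distinct.

  Nondeterminism is used to guess the circuit. Checking it on all \<open>2^n\<close> inputs is
  cheap, because the string itself has more than \<open>2^n\<close> symbols when
  \<open>n > 0\<close>. The size test has to be computable as well, so it adds up bit lengths of
  gate numbers instead of evaluating a bound with real logarithms.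

  The sum of \<open>2^(-f(N))\<close> runs over all \<open>N\<close>, although \<open>A\<close> has
  strings only of lengths \<open>2^(n+1) - 1\<close>. Hence a saving of about \<open>2 log N\<close>
  bits is aimed at, which makes the sum comparable with that of \<open>1 / N^2\<close>.\<close>

type_synonym stacks = "nat \<Rightarrow> bool list"

text \<open>
  Stack 0 is the output, to which symbols are only appended. Each other stack lives on a tape with
  the head on its top element and the bottom to the right, so that popping is a move to the right,
  pushing a move to the left, and whatever lies to the left of the head is irrelevant. The numbers
  in \<open>exec\<close> are exact running times of the compiled program.
\<close>

datatype prog =
    Pop nat
  | Set nat "(nat \<Rightarrow> symbol) \<Rightarrow> bool"
  | Push nat "(nat \<Rightarrow> symbol) \<Rightarrow> bool"
  | Emit "(nat \<Rightarrow> symbol) \<Rightarrow> bool"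
  | Seq prog prog (infixr ";;" 60)
  | If "(nat \<Rightarrow> symbol) \<Rightarrow> bool" prog prog
  | While "(nat \<Rightarrow> symbol) \<Rightarrow> bool" prog

text \<open>Index 0 yields \<open>None\<close> because the output head rests on the blank cell after
  the last emitted symbol. The bound 14 is the number of tapes of the compiled machines.\<close>

definition tops :: "stacks \<Rightarrow> nat \<Rightarrow> symbol" where
  "tops s i = (if 0 < i \<and> i < 14 \<and> s i \<noteq> [] then Some (hd (s i)) else None)"

inductive exec :: "prog \<Rightarrow> stacks \<Rightarrow> nat \<Rightarrow> stacks \<Rightarrow> bool" where
  Pop: "0 < i \<Longrightarrow> i < 14 \<Longrightarrow> exec (Pop i) s 1 (s(i := tl (s i)))"
| Set: "0 < i \<Longrightarrow> i < 14 \<Longrightarrow> exec (Set i e) s 1 (s(i := e (tops s) # tl (s i)))"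
| Push: "0 < i \<Longrightarrow> i < 14 \<Longrightarrow> exec (Push i e) s 2 (s(i := e (tops s) # s i))"
| Emit: "exec (Emit e) s 1 (s(0 := s 0 @ [e (tops s)]))"
| Seq: "exec P s t s' \<Longrightarrow> exec Q s' t' s'' \<Longrightarrow> exec (P ;; Q) s (t + t') s''"
| If_True: "c (tops s) \<Longrightarrow> exec P s t s' \<Longrightarrow> exec (If c P Q) s (t + 2) s'"
| If_False: "\<not> c (tops s) \<Longrightarrow> exec Q s t s' \<Longrightarrow> exec (If c P Q) s (t + 1) s'"
| While_False: "\<not> c (tops s) \<Longrightarrow> exec (While c P) s 1 s"
| While_True: "c (tops s) \<Longrightarrow> exec P s t s' \<Longrightarrow> exec (While c P) s' t' s'' \<Longrightarrow>
    exec (While c P) s (t + t' + 2) s''"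

fun code_size :: "prog \<Rightarrow> nat" where
  "code_size (Pop i) = 1"
| "code_size (Set i e) = 1"
| "code_size (Push i e) = 3"
| "code_size (Emit e) = 1"
| "code_size (P ;; Q) = code_size P + code_size Q"
| "code_size (If c P Q) = code_size P + code_size Q + 2"
| "code_size (While c P) = code_size P + 2"

definition look :: "symbol list \<Rightarrow> nat \<Rightarrow> symbol" where
  "look l i = (if i < length l then l ! i else None)"

definition idle :: "symbol list \<Rightarrow> nat \<Rightarrow> symbol \<times> move" where
  "idle l = (\<lambda>i. (look l i, Stay))"

text \<open>The program occupies the states from \<open>r\<close> on and is left through \<open>r + code_size P\<close>. \<open>Push\<close>
  chooses between two states before it moves, because the symbol to be written may depend on the
  old top of the same stack.\<close>

fun compile :: "prog \<Rightarrow> nat \<Rightarrow> nat \<Rightarrow> symbol list \<Rightarrow> nat \<times> (nat \<Rightarrow> symbol \<times> move)" where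
  "compile (Pop i) r q l = (r + 1, (idle l)(i := (look l i, Right)))"
| "compile (Set i e) r q l = (r + 1, (idle l)(i := (Some (e (look l)), Stay)))"
| "compile (Push i e) r q l =
    (if q = r then (if e (look l) then r + 1 else r + 2, (idle l)(i := (look l i, Left)))
     else (r + 3, (idle l)(i := (Some (q = r + 1), Stay))))"
| "compile (Emit e) r q l = (r + 1, (idle l)(0 := (Some (e (look l)), Right)))"
| "compile (P ;; Q) r q l =
    (if q < r + code_size P then compile P r q l else compile Q (r + code_size P) q l)"
| "compile (If c P Q) r q l =
    (if q = r then (if c (look l) then r + 1 else r + 2 + code_size P, idle l)
     else if q < r + 1 + code_size P then compile P (r + 1) q l
     else if q = r + 1 + code_size P then (r + 2 + code_size P + code_size Q, idle l)
     else compile Q (r + 2 + code_size P) q l)"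
| "compile (While c P) r q l =
    (if q = r then (if c (look l) then r + 1 else r + 2 + code_size P, idle l)
     else if q < r + 1 + code_size P then compile P (r + 1) q l
     else (r, idle l))"

definition tape_stack :: "tape \<Rightarrow> bool list \<Rightarrow> bool" where
  "tape_stack T w \<longleftrightarrow> (\<forall>j. fst T (snd T + int j) = (if j < length w then Some (w ! j) else None))"

definition represents :: "(nat \<Rightarrow> tape) \<Rightarrow> stacks \<Rightarrow> bool" where
  "represents T s \<longleftrightarrow> T 0 = (word_cells (s 0), int (length (s 0))) \<and>
     (\<forall>i. 0 < i \<and> i < 14 \<longrightarrow> tape_stack (T i) (s i))"

lemma scanned_tape_stack: "tape_stack T w \<Longrightarrow> scanned T = (if w = [] then None else Some (hd w))"
  unfolding tape_stack_def scanned_def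
  by (cases T; drule spec[of _ 0]; simp add: hd_conv_nth)

lemma look_represents:
  assumes "represents T s"
  shows "look (map (\<lambda>i. scanned (T i)) [0..<14]) = tops s"
proof
  fix i
  have "scanned (T 0) = None"
    using assms by (simp add: represents_def scanned_def word_cells_def)
  moreover have "scanned (T i) = (if s i = [] then None else Some (hd (s i)))" if "0 < i" "i < 14"
    using assms that by (intro scanned_tape_stack) (simp add: represents_def)
  ultimately show "look (map (\<lambda>i. scanned (T i)) [0..<14]) i = tops s i"
    by (cases "i = 0") (auto simp: look_def tops_def simp del: upt_Suc)
qed

lemma tape_stack_pop:
  assumes "tape_stack (c, h) w"
  shows "tape_stack (c, h + 1) (tl w)"
  unfolding tape_stack_def
proof
  fix j
  have "c (h + int (Suc j)) = (if Suc j < length w then Some (w ! Suc j) else None)"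
    using assms unfolding tape_stack_def by (metis fst_conv snd_conv)
  then show "fst (c, h + 1) (snd (c, h + 1) + int j) =
      (if j < length (tl w) then Some (tl w ! j) else None)"
    by (auto simp: nth_tl add_ac)
qed

lemma tape_stack_set:
  assumes "tape_stack (c, h) w"
  shows "tape_stack (c(h := Some b), h) (b # tl w)"
  unfolding tape_stack_def
proof
  fix j
  have "c (h + int j) = (if j < length w then Some (w ! j) else None)"
    using assms unfolding tape_stack_def by (metis fst_conv snd_conv)
  then show "fst (c(h := Some b), h) (snd (c(h := Some b), h) + int j) =
      (if j < length (b # tl w) then Some ((b # tl w) ! j) else None)"
    by (cases j; cases w) auto
qed

lemma tape_stack_push:
  assumes "tape_stack (c, h) w"
  shows "tape_stack (c(h - 1 := Some b), h - 1) (b # w)"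
  unfolding tape_stack_def
proof
  fix j
  have "c (h + int (j - 1)) = (if j - 1 < length w then Some (w ! (j - 1)) else None)"
    using assms unfolding tape_stack_def by (metis fst_conv snd_conv)
  then show "fst (c(h - 1 := Some b), h - 1) (snd (c(h - 1 := Some b), h - 1) + int j) =
      (if j < length (b # w) then Some ((b # w) ! j) else None)"
    by (cases j) auto
qed

lemma represents_upd:
  assumes "represents T s" "0 < i" "i < 14" "tape_stack (T' i) w" "\<And>j. j \<noteq> i \<Longrightarrow> T' j = T j"
  shows "represents T' (s(i := w))"
  using assms by (auto simp: represents_def)

lemma word_cells_append: "(word_cells w)(int (length w) := Some b) = word_cells (w @ [b])"
  by (auto simp: word_cells_def nth_append fun_eq_iff)

lemma step_idle:
  assumes "q < num_states M" "num_tapes M = 14"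
    and "transition M q l = (q', (idle l)(i := a))"
    and "l = map (\<lambda>i. scanned (T i)) [0..<14]" "i < 14"
  shows "step M (q, T) = (q', T(i := act a (T i)))"
proof -
  have "act (look l j, Stay) (T j) = T j" if "j < 14" for j
    using that by (cases "T j") (simp add: act_def scanned_def look_def assms(4) del: upt_Suc)
  then show ?thesis
    using assms by (auto simp: step_def Let_def idle_def fun_eq_iff simp del: upt_Suc)
qed

lemma step_idle':
  assumes "q < num_states M" "num_tapes M = 14"
    and "transition M q l = (q', idle l)"
    and "l = map (\<lambda>i. scanned (T i)) [0..<14]"
  shows "step M (q, T) = (q', T)"
proof -
  \<comment> \<open>Writing back the scanned symbol on tape 0 is itself the idle action, so
    \<open>step_idle\<close> covers this case too.\<close>
  have "act (look l 0, Stay) (T 0) = T 0"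
    by (cases "T 0") (simp add: act_def scanned_def look_def assms(4) del: upt_Suc)
  then show ?thesis
    using step_idle[OF assms(1,2) _ assms(4), of q' 0 "(look l 0, Stay)"] assms(3)
    by (simp add: idle_def fun_upd_idem)
qed

text \<open>\<open>M\<close> has to agree with the compiled code only on the states occupied by
  \<open>P\<close>, so the induction hypotheses apply to subprograms placed inside a larger
  program.\<close>

theorem compile_correct:
  assumes "exec P s t s'" "represents T s" "num_tapes M = 14"
    and "\<And>q. r \<le> q \<Longrightarrow> q < r + code_size P \<Longrightarrow> transition M q = compile P r q"
    and "r + code_size P \<le> num_states M"
  shows "\<exists>T'. (step M ^^ t) (r, T) = (r + code_size P, T') \<and> represents T' s'"
  using assms
proof (induction arbitrary: T r rule: exec.induct)
  case (Pop i s)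
  let ?l = "map (\<lambda>i. scanned (T i)) [0..<14]"
  have "step M (r, T) = (r + 1, T(i := act (look ?l i, Right) (T i)))"
    by (rule step_idle) (use Pop in \<open>auto simp del: upt_Suc\<close>)
  moreover obtain c h where T: "T i = (c, h)" by force
  have "look ?l i = c h" using T Pop by (simp add: look_def scanned_def del: upt_Suc)
  moreover have "represents (T(i := act (c h, Right) (T i))) (s(i := tl (s i)))"
    using Pop T by (intro represents_upd[of T s]) (auto simp: act_def intro!: tape_stack_pop simp: represents_def)
  ultimately show ?case by (simp add: fun_upd_def)
next
  case (Set i e s)
  let ?l = "map (\<lambda>i. scanned (T i)) [0..<14]"
  have "step M (r, T) = (r + 1, T(i := act (Some (e (look ?l)), Stay) (T i)))"
    by (rule step_idle) (use Set in \<open>auto simp del: upt_Suc\<close>)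
  moreover obtain c h where T: "T i = (c, h)" by force
  have "look ?l = tops s" using Set by (intro look_represents)
  moreover have "represents (T(i := act (Some (e (tops s)), Stay) (T i))) (s(i := e (tops s) # tl (s i)))"
    using Set T by (intro represents_upd[of T s]) (auto simp: act_def intro!: tape_stack_set simp: represents_def)
  ultimately show ?case by (simp add: fun_upd_def)
next
  case (Push i e s)
  let ?l = "map (\<lambda>i. scanned (T i)) [0..<14]"
  have l: "look ?l = tops s" using Push by (intro look_represents)
  obtain c h where T: "T i = (c, h)" by force
  have li: "look ?l i = c h" using T Push by (simp add: look_def scanned_def del: upt_Suc)
  define T1 where "T1 = T(i := (c, h - 1))"
  let ?q = "if e (tops s) then r + 1 else r + 2"
  have 1: "step M (r, T) = (?q, T(i := act (look ?l i, Left) (T i)))"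
    by (rule step_idle) (use Push in \<open>auto simp del: upt_Suc simp: l\<close>)
  have 1: "step M (r, T) = (?q, T1)"
    unfolding 1 by (simp add: T1_def li act_def T)
  have 2: "step M (?q, T1) = (r + 3, T1(i := act (Some (?q = r + 1), Stay) (T1 i)))"
    by (rule step_idle) (use Push in \<open>auto simp del: upt_Suc\<close>)
  have "represents (T1(i := act (Some (?q = r + 1), Stay) (T1 i))) (s(i := e (tops s) # s i))"
    using Push T by (intro represents_upd[of T s])
      (auto simp: act_def T1_def intro!: tape_stack_push simp: represents_def)
  with 1 2 show ?case by (simp add: numeral_2_eq_2 fun_upd_def)
next
  case (Emit e s)
  let ?l = "map (\<lambda>i. scanned (T i)) [0..<14]"
  have "step M (r, T) = (r + 1, T(0 := act (Some (e (look ?l)), Right) (T 0)))"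
    by (rule step_idle) (use Emit in \<open>auto simp del: upt_Suc\<close>)
  moreover have "look ?l = tops s" using Emit by (intro look_represents)
  moreover have "represents (T(0 := act (Some (e (tops s)), Right) (T 0))) (s(0 := s 0 @ [e (tops s)]))"
    using Emit by (auto simp: represents_def act_def word_cells_append)
  ultimately show ?case by (simp add: fun_upd_def)
next
  case (Seq P s t s' Q t' s'')
  have "\<exists>T'. (step M ^^ t) (r, T) = (r + code_size P, T') \<and> represents T' s'"
    by (rule Seq.IH(1)) (use Seq.prems in \<open>auto simp: fun_eq_iff\<close>)
  then obtain T' where T': "(step M ^^ t) (r, T) = (r + code_size P, T')" "represents T' s'" by blast
  have "\<exists>T''. (step M ^^ t') (r + code_size P, T') = (r + code_size P + code_size Q, T'') \<and> represents T'' s''"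
    by (rule Seq.IH(2)) (use Seq.prems T' in \<open>auto simp: fun_eq_iff\<close>)
  then show ?case using T' by (subst add.commute) (auto simp: funpow_add add_ac)
next
  case (If_True c s P t s' Q)
  let ?l = "map (\<lambda>i. scanned (T i)) [0..<14]"
  have l: "look ?l = tops s" using If_True by (intro look_represents)
  have 1: "step M (r, T) = (r + 1, T)"
    by (rule step_idle') (use If_True in \<open>auto simp del: upt_Suc simp: l\<close>)
  have "\<exists>T'. (step M ^^ t) (r + 1, T) = (r + 1 + code_size P, T') \<and> represents T' s'"
    by (rule If_True.IH) (use If_True.prems in \<open>auto simp: fun_eq_iff\<close>)
  then obtain T' where T': "(step M ^^ t) (r + 1, T) = (r + 1 + code_size P, T')" "represents T' s'" by blast
  have 2: "step M (r + 1 + code_size P, T') = (r + 2 + code_size P + code_size Q, T')"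
    by (rule step_idle') (use If_True in \<open>auto simp del: upt_Suc\<close>)
  have "(step M ^^ (t + 2)) (r, T) = step M ((step M ^^ t) (step M (r, T)))"
    by (simp add: funpow_swap1)
  then show ?case using 1 2 T' by (simp add: add_ac)
next
  case (If_False c s Q t s' P)
  let ?l = "map (\<lambda>i. scanned (T i)) [0..<14]"
  have l: "look ?l = tops s" using If_False by (intro look_represents)
  have 1: "step M (r, T) = (r + 2 + code_size P, T)"
    by (rule step_idle') (use If_False in \<open>auto simp del: upt_Suc simp: l\<close>)
  have "\<exists>T'. (step M ^^ t) (r + 2 + code_size P, T) = (r + 2 + code_size P + code_size Q, T') \<and> represents T' s'"
    by (rule If_False.IH) (use If_False.prems in \<open>auto simp: fun_eq_iff\<close>)
  then show ?case using 1 by (auto simp: funpow_swap1 add_ac)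
next
  case (While_False c s P)
  let ?l = "map (\<lambda>i. scanned (T i)) [0..<14]"
  have l: "look ?l = tops s" using While_False by (intro look_represents)
  have "step M (r, T) = (r + 2 + code_size P, T)"
    by (rule step_idle') (use While_False in \<open>auto simp del: upt_Suc simp: l\<close>)
  then show ?case using While_False.prems by (simp add: add_ac)
next
  case (While_True c s P t s' t' s'')
  let ?l = "map (\<lambda>i. scanned (T i)) [0..<14]"
  have l: "look ?l = tops s" using While_True by (intro look_represents)
  have 1: "step M (r, T) = (r + 1, T)"
    by (rule step_idle') (use While_True in \<open>auto simp del: upt_Suc simp: l\<close>)
  have "\<exists>T'. (step M ^^ t) (r + 1, T) = (r + 1 + code_size P, T') \<and> represents T' s'"
    by (rule While_True.IH) (use While_True.prems in \<open>auto simp: fun_eq_iff\<close>)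
  then obtain T' where T': "(step M ^^ t) (r + 1, T) = (r + 1 + code_size P, T')" "represents T' s'" by blast
  have 2: "step M (r + 1 + code_size P, T') = (r, T')"
    by (rule step_idle') (use While_True in \<open>auto simp del: upt_Suc\<close>)
  have "\<exists>T''. (step M ^^ t') (r, T') = (r + code_size (While c P), T'') \<and> represents T'' s''"
    by (rule While_True.IH) (use While_True.prems T' in auto)
  moreover have "(step M ^^ (t + t' + 2)) (r, T) = (step M ^^ t') (step M ((step M ^^ t) (step M (r, T))))"
    by (metis (no_types, lifting) add.commute add_2_eq_Suc comp_apply funpow_add funpow_simps_right(2) funpow_swap1 add_Suc_right)
  ultimately show ?case using 1 2 T' by simp
qed

text \<open>Unlike the exact times of \<open>exec\<close>, upper bounds can be weakened, so branches
  of different length share one bound and all rounds of a loop can be charged alike.\<close>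

definition runs :: "prog \<Rightarrow> stacks \<Rightarrow> nat \<Rightarrow> stacks \<Rightarrow> bool" where
  "runs P s t s' \<longleftrightarrow> (\<exists>t'\<le>t. exec P s t' s')"

definition input_stacks :: "bool list list \<Rightarrow> stacks" where
  "input_stacks ws i = (if 1 \<le> i \<and> i \<le> length ws then ws ! (i - 1) else [])"

text \<open>No set-up phase occurs: a word written from cell 0, with the head on cell 0, already is
  a stack with its first symbol on top. The exit state \<open>code_size P\<close> equals
  \<open>num_states\<close>, so leaving the program means halting.\<close>

theorem polytimeI:
  fixes p :: "nat poly"
  assumes "\<And>a. \<exists>s. runs P (input_stacks (inp a)) (poly p (sum_list (map length (inp a)))) s \<and> s 0 = out a"
  shows "polytime inp out"
proof -
  define M where "M = \<lparr>num_tapes = 14, num_states = code_size P, transition = compile P 0\<rparr>"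
  have "computes_within M (inp a) (poly p (sum_list (map length (inp a)))) (out a)" (is "computes_within M ?i ?t _")
    for a
  proof -
    obtain s t where s: "exec P (input_stacks ?i) t s" "t \<le> ?t" "s 0 = out a"
      using assms[of a] by (auto simp: runs_def)
    have "represents (snd (initial ?i)) (input_stacks ?i)"
      by (auto simp: represents_def initial_def input_stacks_def tape_stack_def word_cells_def fun_eq_iff)
    then have "\<exists>T'. (step M ^^ t) (0, snd (initial ?i)) = (0 + code_size P, T') \<and> represents T' s"
      by (intro compile_correct[OF s(1)]) (auto simp: M_def)
    then obtain T' where T': "(step M ^^ t) (initial ?i) = (code_size P, T')" "represents T' s"
      by (auto simp: initial_def)
    have fixed: "(step M ^^ d) (code_size P, T') = (code_size P, T')" for d
      by (induction d) (auto simp: step_def M_def)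
    have "(step M ^^ ?t) (initial ?i) = (step M ^^ (?t - t)) ((step M ^^ t) (initial ?i))"
      using s(2) by (metis comp_apply funpow_add le_add_diff_inverse2)
    then have "(step M ^^ ?t) (initial ?i) = (code_size P, T')"
      using T' fixed by simp
    then show ?thesis using T' s(3)
      by (auto simp: computes_within_def represents_def word_cells_def M_def)
  qed
  then show ?thesis unfolding polytime_def by blast
qed

lemma runs_mono: "runs P s t s' \<Longrightarrow> s' = s'' \<Longrightarrow> t \<le> t' \<Longrightarrow> runs P s t' s''"
  unfolding runs_def by (meson le_trans)

lemma runs_Pop: "0 < i \<Longrightarrow> i < 14 \<Longrightarrow> runs (Pop i) s 1 (s(i := tl (s i)))"
  unfolding runs_def by (blast intro: exec.Pop)

lemma runs_Set: "0 < i \<Longrightarrow> i < 14 \<Longrightarrow> runs (Set i e) s 1 (s(i := e (tops s) # tl (s i)))"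
  unfolding runs_def by (blast intro: exec.Set)

lemma runs_Push: "0 < i \<Longrightarrow> i < 14 \<Longrightarrow> runs (Push i e) s 2 (s(i := e (tops s) # s i))"
  unfolding runs_def by (blast intro: exec.Push)

lemma runs_Emit: "runs (Emit e) s 1 (s(0 := s 0 @ [e (tops s)]))"
  unfolding runs_def by (blast intro: exec.Emit)

lemma runs_Seq: "runs P s t s' \<Longrightarrow> runs Q s' t' s'' \<Longrightarrow> runs (P ;; Q) s (t + t') s''"
  unfolding runs_def by (meson add_le_mono exec.Seq)

lemma runs_If:
  assumes "c (tops s) \<Longrightarrow> runs P s t s'" "\<not> c (tops s) \<Longrightarrow> runs Q s t s'"
  shows "runs (If c P Q) s (t + 2) s'"
proof (cases "c (tops s)")
  case True
  then obtain t' where "t' \<le> t" "exec P s t' s'" using assms(1) by (auto simp: runs_def)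
  with exec.If_True[of c, OF True] show ?thesis unfolding runs_def by (meson add_le_mono1)
next
  case False
  then obtain t' where "t' \<le> t" "exec Q s t' s'" using assms(2) by (auto simp: runs_def)
  then have "exec (If c P Q) s (t' + 1) s'" "t' + 1 \<le> t + 2" using exec.If_False[of c, OF False] by auto
  then show ?thesis unfolding runs_def by blast
qed

lemma runs_While_False: "\<not> c (tops s) \<Longrightarrow> runs (While c P) s 1 s"
  unfolding runs_def by (blast intro: exec.While_False)

lemma runs_While_True:
  assumes "c (tops s)" "runs P s t s'" "runs (While c P) s' t' s''"
  shows "runs (While c P) s (t + t' + 2) s''"
proof -
  obtain u u' where "u \<le> t" "exec P s u s'" "u' \<le> t'" "exec (While c P) s' u' s''"
    using assms by (auto simp: runs_def)
  with exec.While_True[of c, OF assms(1)] show ?thesis unfolding runs_def by (meson add_le_mono add_le_mono1)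
qed

lemma runs_While:
  assumes "\<And>j. j < m \<Longrightarrow> c (tops (st j)) \<and> runs P (st j) b (st (Suc j))" "\<not> c (tops (st m))"
  shows "runs (While c P) (st 0) (m * (b + 2) + 1) (st m)"
  using assms
proof (induction m arbitrary: st)
  case 0
  then show ?case using runs_While_False by simp
next
  case (Suc m)
  have "runs (While c P) (st (Suc 0)) (m * (b + 2) + 1) (st (Suc m))"
    using Suc.prems by (intro Suc.IH[of "\<lambda>j. st (Suc j)"]) auto
  moreover have "c (tops (st 0))" "runs P (st 0) b (st (Suc 0))" using Suc.prems by auto
  ultimately have "runs (While c P) (st 0) (b + (m * (b + 2) + 1) + 2) (st (Suc m))"
    by (intro runs_While_True)
  then show ?case by (rule runs_mono) auto
qed

section \<open>Counters and copying\<close>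

definition nonempty :: "nat \<Rightarrow> (nat \<Rightarrow> symbol) \<Rightarrow> bool" where
  "nonempty i a \<longleftrightarrow> a i \<noteq> None"

definition top_true :: "nat \<Rightarrow> (nat \<Rightarrow> symbol) \<Rightarrow> bool" where
  "top_true i a \<longleftrightarrow> a i = Some True"

lemma nonempty_tops [simp]: "0 < i \<Longrightarrow> i < 14 \<Longrightarrow> nonempty i (tops s) \<longleftrightarrow> s i \<noteq> []"
  by (simp add: nonempty_def tops_def)

lemma top_true_tops [simp]:
  "0 < i \<Longrightarrow> i < 14 \<Longrightarrow> top_true i (tops s) \<longleftrightarrow> s i \<noteq> [] \<and> hd (s i)"
  by (simp add: top_true_def tops_def)

definition clear :: "nat \<Rightarrow> prog" where
  "clear i = While (nonempty i) (Pop i)"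

lemma runs_clear:
  assumes "0 < i" "i < 14"
  shows "runs (clear i) s (3 * length (s i) + 1) (s(i := []))"
proof (induction "s i" arbitrary: s)
  case Nil
  then show ?case using assms unfolding clear_def
    by (intro runs_mono[OF runs_While_False]) (auto simp: fun_eq_iff)
next
  case (Cons b w)
  let ?s = "s(i := w)"
  have h1: "runs (clear i) ?s (3 * length (?s i) + 1) (?s(i := []))" by (rule Cons.hyps) simp
  have h2: "runs (Pop i) s 1 ?s"
    using assms Cons(2) by (intro runs_mono[OF runs_Pop]) (auto simp: Cons(2)[symmetric])
  have h3: "nonempty i (tops s)" using assms Cons(2) by (auto simp flip: Cons(2))
  show ?case unfolding clear_def
    by (intro runs_mono[OF runs_While_True[OF h3 h2 h1[unfolded clear_def]]]) (auto simp flip: Cons(2))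
qed

definition transfer :: "nat \<Rightarrow> nat \<Rightarrow> prog" where
  "transfer i j = While (nonempty i) (Push j (top_true i) ;; Pop i)"

lemma runs_transfer:
  assumes "0 < i" "i < 14" "0 < j" "j < 14" "i \<noteq> j"
  shows "runs (transfer i j) s (5 * length (s i) + 1) (s(i := [], j := rev (s i) @ s j))"
proof (induction "s i" arbitrary: s)
  case Nil
  then show ?case using assms unfolding transfer_def
    by (intro runs_mono[OF runs_While_False]) (auto simp: fun_eq_iff)
next
  case (Cons b w)
  let ?s = "s(i := w, j := b # s j)"
  have h1: "runs (transfer i j) ?s (5 * length (?s i) + 1) (?s(i := [], j := rev (?s i) @ ?s j))"
    using assms by (intro Cons.hyps) simp
  have h2: "runs (Push j (top_true i) ;; Pop i) s 3 ?s"
    using assms by (intro runs_mono[OF runs_Seq[OF runs_Push runs_Pop]])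
      (auto simp: fun_eq_iff simp flip: Cons(2))
  have h3: "nonempty i (tops s)" using assms by (auto simp flip: Cons(2))
  show ?case unfolding transfer_def using assms
    by (intro runs_mono[OF runs_While_True[OF h3 h2 h1[unfolded transfer_def]]]) (auto simp: fun_eq_iff simp flip: Cons(2))
qed

definition copy :: "nat \<Rightarrow> nat \<Rightarrow> nat \<Rightarrow> prog" where
  "copy i j k = transfer i k ;;
     While (nonempty k) (Push i (top_true k) ;; Push j (top_true k) ;; Pop k)"

lemma runs_copy:
  assumes "0 < i" "i < 14" "0 < j" "j < 14" "0 < k" "k < 14" "i \<noteq> j" "i \<noteq> k" "j \<noteq> k"
    and "s k = []"
  shows "runs (copy i j k) s (12 * length (s i) + 2) (s(j := s i @ s j))"
proof -
  have *: "runs (While (nonempty k) (Push i (top_true k) ;; Push j (top_true k) ;; Pop k)) s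
      (7 * length (s k) + 1) (s(k := [], i := rev (s k) @ s i, j := rev (s k) @ s j))" for s
  proof (induction "s k" arbitrary: s)
    case Nil
    then show ?case using assms by (intro runs_mono[OF runs_While_False]) (auto simp: fun_eq_iff)
  next
    case (Cons b w)
    let ?s = "s(k := w, i := b # s i, j := b # s j)"
    have h1: "runs (While (nonempty k) (Push i (top_true k) ;; Push j (top_true k) ;; Pop k)) ?s
      (7 * length (?s k) + 1) (?s(k := [], i := rev (?s k) @ ?s i, j := rev (?s k) @ ?s j))"
      using assms by (intro Cons.hyps) simp
    have h2: "runs (Push i (top_true k) ;; Push j (top_true k) ;; Pop k) s 5 ?s"
      using assms by (intro runs_mono[OF runs_Seq[OF runs_Push runs_Seq[OF runs_Push runs_Pop]]])
        (auto simp: fun_eq_iff simp flip: Cons(2))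
    have h3: "nonempty k (tops s)" using assms by (auto simp flip: Cons(2))
    show ?case using assms
      by (intro runs_mono[OF runs_While_True[OF h3 h2 h1]]) (auto simp: fun_eq_iff simp flip: Cons(2))
  qed
  show ?thesis unfolding copy_def using assms
    by (intro runs_mono[OF runs_Seq[OF runs_transfer *]]) (auto simp: fun_eq_iff)
qed

text \<open>The successor in the standard enumeration, on words stored last letter first. Since
  \<open>std_enum n\<close> is the binary form of \<open>n + 1\<close> without its leading 1, a
  carry that runs through the whole word lengthens it.\<close>

fun incr :: "bool list \<Rightarrow> bool list" where
  "incr [] = [False]"
| "incr (False # w) = True # w"
| "incr (True # w) = False # incr w"

lemma incr_rev_std_enum: "incr (rev (std_enum n)) = rev (std_enum (Suc n))"
proof (induction n rule: less_induct)
  case (less n)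
  show ?case
  proof (cases n)
    case (Suc m)
    show ?thesis
    proof (cases "odd m")
      case True
      then have "Suc m div 2 = Suc (m div 2)" by presburger
      then show ?thesis using True less[of "m div 2"] Suc by simp
    next
      case False
      then have "Suc m div 2 = m div 2" by presburger
      then show ?thesis using False Suc by simp
    qed
  qed simp
qed

lemma length_incr: "length (incr w) = length w + (if \<forall>b\<in>set w. b then 1 else 0)"
  by (induction w rule: incr.induct) auto

text \<open>Stack \<open>k\<close> parks the zeros left behind by the carry, and \<open>v\<close>
  records whether the word grew. Stack \<open>v\<close> may be empty beforehand, as
  \<open>Set\<close> then acts as a push.\<close>

definition increment :: "nat \<Rightarrow> nat \<Rightarrow> nat \<Rightarrow> prog" where
  "increment i k v =
     While (top_true i) (Pop i ;; Push k (\<lambda>_. False)) ;;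
     If (nonempty i) (Set i (\<lambda>_. True) ;; Set v (\<lambda>_. False)) (Push i (\<lambda>_. False) ;; Set v (\<lambda>_. True)) ;;
     While (nonempty k) (Push i (\<lambda>_. False) ;; Pop k)"

lemma runs_increment:
  assumes "0 < i" "i < 14" "0 < k" "k < 14" "0 < v" "v < 14" "i \<noteq> k" "i \<noteq> v" "k \<noteq> v"
    and "s k = []"
  shows "runs (increment i k v) s (10 * length (s i) + 7)
    (s(i := incr (s i), v := (\<forall>b\<in>set (s i). b) # tl (s v)))"
proof -
  have 1: "runs (While (top_true i) (Pop i ;; Push k (\<lambda>_. False))) s (5 * length (s i) + 1)
    (s(i := dropWhile id (s i), k := replicate (length (takeWhile id (s i))) False @ s k))" for s
  proof (induction "s i" arbitrary: s)
    case Nil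
    then show ?case using assms by (intro runs_mono[OF runs_While_False]) (auto simp: fun_eq_iff)
  next
    case (Cons b w)
    show ?case
    proof (cases b)
      case False
      then show ?thesis using assms 
        by (intro runs_mono[OF runs_While_False]) (auto simp: fun_eq_iff simp flip: Cons(2))
    next
      case True
      let ?s = "s(i := w, k := False # s k)"
      have h1: "runs (While (top_true i) (Pop i ;; Push k (\<lambda>_. False))) ?s (5 * length (?s i) + 1)
        (?s(i := dropWhile id (?s i), k := replicate (length (takeWhile id (?s i))) False @ ?s k))"
        using assms by (intro Cons.hyps) simp
      have h2: "runs (Pop i ;; Push k (\<lambda>_. False)) s 3 ?s"
        using assms by (intro runs_mono[OF runs_Seq[OF runs_Pop runs_Push]])
          (auto simp: fun_eq_iff simp flip: Cons(2))
      have h3: "top_true i (tops s)" using assms True by (auto simp flip: Cons(2))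
      show ?thesis using assms True
        by (intro runs_mono[OF runs_While_True[OF h3 h2 h1]])
          (auto simp: fun_eq_iff replicate_app_Cons_same simp flip: Cons(2))
    qed
  qed
  have 3: "runs (While (nonempty k) (Push i (\<lambda>_. False) ;; Pop k)) s (5 * length (s k) + 1)
    (s(i := replicate (length (s k)) False @ s i, k := []))" for s
  proof (induction "s k" arbitrary: s)
    case Nil
    then show ?case using assms by (intro runs_mono[OF runs_While_False]) (auto simp: fun_eq_iff)
  next
    case (Cons b w)
    let ?s = "s(k := w, i := False # s i)"
    have h1: "runs (While (nonempty k) (Push i (\<lambda>_. False) ;; Pop k)) ?s (5 * length (?s k) + 1)
      (?s(i := replicate (length (?s k)) False @ ?s i, k := []))"
      using assms by (intro Cons.hyps) simp
    have h2: "runs (Push i (\<lambda>_. False) ;; Pop k) s 3 ?s"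
      using assms by (intro runs_mono[OF runs_Seq[OF runs_Push runs_Pop]])
        (auto simp: fun_eq_iff simp flip: Cons(2))
    have h3: "nonempty k (tops s)" using assms by (auto simp flip: Cons(2))
    show ?case using assms
      by (intro runs_mono[OF runs_While_True[OF h3 h2 h1]])
        (auto simp: fun_eq_iff replicate_app_Cons_same simp flip: Cons(2))
  qed
  have 2: "runs (If (nonempty i) (Set i (\<lambda>_. True) ;; Set v (\<lambda>_. False)) (Push i (\<lambda>_. False) ;; Set v (\<lambda>_. True)))
      s (3 + 2) (s(i := (if s i = [] then [False] else True # tl (s i)), v := (s i = []) # tl (s v)))" for s
  proof (rule runs_If)
    assume "nonempty i (tops s)"
    then show "runs (Set i (\<lambda>_. True) ;; Set v (\<lambda>_. False)) s 3
        (s(i := (if s i = [] then [False] else True # tl (s i)), v := (s i = []) # tl (s v)))"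
      using assms by (intro runs_mono[OF runs_Seq[OF runs_Set runs_Set]]) (auto simp: fun_eq_iff)
  next
    assume "\<not> nonempty i (tops s)"
    then show "runs (Push i (\<lambda>_. False) ;; Set v (\<lambda>_. True)) s 3
        (s(i := (if s i = [] then [False] else True # tl (s i)), v := (s i = []) # tl (s v)))"
      using assms by (intro runs_mono[OF runs_Seq[OF runs_Push runs_Set]]) (auto simp: fun_eq_iff)
  qed
  have eq: "incr w = replicate (length (takeWhile id w)) False @
      (if dropWhile id w = [] then [False] else True # tl (dropWhile id w))" for w
    by (induction w rule: incr.induct) auto
  have len: "length (takeWhile id w) \<le> length w" for w :: "bool list"
    by (simp add: length_takeWhile_le)
  show ?thesis unfolding increment_def using assms len[of "s i"]
    by (intro runs_mono[OF runs_Seq[OF 1 runs_Seq[OF 2 3]]]) (auto simp: fun_eq_iff eq[of "s i"])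
qed

definition count_up :: "nat \<Rightarrow> nat \<Rightarrow> prog" where
  "count_up i j = While (nonempty i) (Pop i ;; increment j 7 8 ;; Pop 8)"

lemma length_std_enum_le: "length (std_enum n) \<le> n"
  by (induction n rule: std_enum.induct) (auto intro: order_trans[OF _ div_le_dividend])

lemma runs_count_up:
  assumes "0 < i" "i < 14" "0 < j" "j < 14" "i \<noteq> j" "i \<notin> {7, 8}" "j \<notin> {7, 8}"
    and "s j = []" "s 7 = []" "s 8 = []"
  shows "runs (count_up i j) s (length (s i) * (10 * length (s i) + 11) + 1)
    (s(i := [], j := rev (std_enum (length (s i)))))"
proof -
  define st where "st m = s(i := drop m (s i), j := rev (std_enum m))" for m
  have "runs (Pop i ;; increment j 7 8 ;; Pop 8) (st m) (10 * length (s i) + 9) (st (Suc m))"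
    if "m < length (s i)" for m
    unfolding st_def using assms that order_trans[OF length_std_enum_le less_imp_le[OF that]]
    by (intro runs_mono[OF runs_Seq[OF runs_Pop runs_Seq[OF runs_increment runs_Pop]]])
      (auto simp: fun_eq_iff incr_rev_std_enum drop_Suc tl_drop)
  moreover have "nonempty i (tops (st m)) \<longleftrightarrow> m < length (s i)" for m
    using assms by (auto simp: st_def)
  ultimately have "runs (count_up i j) (st 0) (length (s i) * (10 * length (s i) + 9 + 2) + 1) (st (length (s i)))"
    unfolding count_up_def by (intro runs_While) auto
  moreover have "st 0 = s" using assms by (simp add: st_def fun_eq_iff)
  ultimately show ?thesis using assms by (auto elim!: runs_mono simp: st_def)
qed

definition emit_all :: "nat \<Rightarrow> prog" where
  "emit_all i = While (nonempty i) (Emit (top_true i) ;; Pop i)"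

lemma runs_emit_all:
  assumes "0 < i" "i < 14"
  shows "runs (emit_all i) s (4 * length (s i) + 1) (s(0 := s 0 @ s i, i := []))"
proof (induction "s i" arbitrary: s)
  case Nil
  then show ?case using assms unfolding emit_all_def
    by (intro runs_mono[OF runs_While_False]) (auto simp: fun_eq_iff)
next
  case (Cons b w)
  let ?s = "s(i := w, 0 := s 0 @ [b])"
  have h1: "runs (emit_all i) ?s (4 * length (?s i) + 1) (?s(0 := ?s 0 @ ?s i, i := []))"
    using assms by (intro Cons.hyps) simp
  have h2: "runs (Emit (top_true i) ;; Pop i) s 2 ?s"
    using assms by (intro runs_mono[OF runs_Seq[OF runs_Emit runs_Pop]])
      (auto simp: fun_eq_iff simp flip: Cons(2))
  have h3: "nonempty i (tops s)" using assms by (auto simp flip: Cons(2))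
  show ?case unfolding emit_all_def using assms
    by (intro runs_mono[OF runs_While_True[OF h3 h2 h1[unfolded emit_all_def]]]) (auto simp: fun_eq_iff simp flip: Cons(2))
qed

section \<open>Polynomial-time computability of the convergence modulus and of
  \<open>f\<close>\<close>

lemma binary_Suc: "binary (Suc n) = True # std_enum n"
proof (induction n rule: less_induct)
  case (less n)
  show ?case
  proof (cases n)
    case (Suc m)
    have "Suc n div 2 = Suc (m div 2)" using Suc by simp
    then show ?thesis using less[of "m div 2"] Suc by (subst binary.simps) simp
  qed (subst binary.simps; simp)
qed

lemma binary_double: "0 < n \<Longrightarrow> binary (2 * n) = binary n @ [False]"
  by (subst binary.simps) simp

lemma binary_power2: "binary (2 ^ n) = True # replicate n False"
proof (induction n)
  case 0
  show ?case by (subst binary.simps) simp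
next
  case (Suc n)
  then show ?case using binary_double[of "2 ^ n"] by (simp add: replicate_append_same)
qed

text \<open>The unary input consists of zeros, so a one followed by the input is already the answer.
  This function serves as the modulus of convergence.\<close>

lemma polytime_nat_power2: "polytime_nat (\<lambda>n. 2 ^ n)"
  unfolding polytime_nat_def
proof (rule polytimeI)
  fix n :: nat
  let ?s = "input_stacks [replicate n False]"
  have "runs (Emit (\<lambda>_. True) ;; emit_all 1) ?s (4 * n + 2)
    (?s(0 := True # replicate n False, 1 := []))"
    by (intro runs_mono[OF runs_Seq[OF runs_Emit runs_emit_all]]) (auto simp: input_stacks_def)
  then show "\<exists>s. runs (Emit (\<lambda>_. True) ;; emit_all 1) ?s
      (poly [:2, 4:] (sum_list (map length [replicate n False]))) s \<and> s 0 = binary (2 ^ n)"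
    by - (rule exI, rule conjI, erule runs_mono[OF _ refl], auto simp: binary_power2)
qed

definition twice_log :: "nat \<Rightarrow> nat" where
  "twice_log n = 2 * Suc (length (std_enum n))"

text \<open>Counting the letters of the word for \<open>n\<close> gives the word for its length
  \<open>k\<close>. By \<open>binary_Suc\<close> a leading 1 turns this into the binary form of
  \<open>k + 1\<close>, and a trailing 0 doubles it.\<close>

lemma polytime_nat_twice_log: "polytime_nat twice_log"
  unfolding polytime_nat_def
proof (rule polytimeI)
  fix n :: nat
  let ?s = "input_stacks [replicate n False]"
  let ?P = "count_up 1 4 ;; count_up 4 11 ;; transfer 11 9 ;; Emit (\<lambda>_. True) ;; emit_all 9 ;; Emit (\<lambda>_. False)"
  define k where "k = length (std_enum n)"
  define l where "l = length (std_enum k)"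
  have k: "k \<le> n" "l \<le> n" using length_std_enum_le order_trans unfolding k_def l_def by blast+
  have "runs ?P ?s ((n * (10 * n + 11) + 1) + ((k * (10 * k + 11) + 1) + ((5 * l + 1) + (1 + ((4 * l + 1) + 1)))))
    (?s(1 := [], 4 := [], 11 := [], 0 := True # std_enum k @ [False]))"
    by (rule runs_mono[OF runs_Seq[OF runs_count_up runs_Seq[OF runs_count_up runs_Seq[OF runs_transfer
        runs_Seq[OF runs_Emit runs_Seq[OF runs_emit_all runs_Emit]]]]]])
      (auto simp: input_stacks_def fun_eq_iff k_def l_def)
  moreover have "k * (10 * k + 11) \<le> n * (10 * n + 11)" using k by (intro mult_mono) auto
  ultimately have "runs ?P ?s (2 * (n * (10 * n + 11)) + 9 * n + 6)
    (?s(1 := [], 4 := [], 11 := [], 0 := True # std_enum k @ [False]))"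
    using k by (elim runs_mono) auto
  then show "\<exists>s. runs ?P ?s (poly [:6, 31, 20:] (sum_list (map length [replicate n False]))) s \<and>
      s 0 = binary (twice_log n)"
    by - (rule exI, rule conjI, erule runs_mono[OF _ refl],
      auto simp: twice_log_def binary_double binary_Suc algebra_simps k_def simp del: mult_Suc_right)
qed

section \<open>The verifier\<close>

text \<open>
  A certificate is a list of gates, each given by \<open>1\<^sup>a 0 1\<^sup>b 0\<close> and the four bits of its truth table.
  The numbers \<open>a\<close> and \<open>b\<close> are distances from the newest wire, as the wire values form a stack with
  the newest on top. Every word is read as a certificate: missing symbols and wires count as
  \<open>False\<close>. Stacks: 1 the string, 2 the certificate, 3 the budget of the size check, 4 the current input,
  5 and 6 the wires below and above the pointer, 7 scratch, 8 and 9 the operands of a gate, 10 the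
  unread part of the certificate, 11 the gate counter, 12 and 13 flags.
\<close>

definition wire :: "bool list \<Rightarrow> nat \<Rightarrow> bool" where
  "wire w a \<longleftrightarrow> a < length w \<and> w ! a"

definition pointer :: "bool list \<Rightarrow> nat" where
  "pointer y = length (takeWhile id y)"

definition after_pointer :: "bool list \<Rightarrow> bool list" where
  "after_pointer y = tl (dropWhile id y)"

text \<open>The wires above the addressed one are parked on stack 6 and put back afterwards. If
  stack 5 runs out, its top is \<open>None\<close>, which \<open>top_true\<close> reads as
  \<open>False\<close>.\<close>

definition read_pointer :: "nat \<Rightarrow> prog" where
  "read_pointer r =
     While (top_true 10) (Pop 10 ;; If (nonempty 5) (Push 6 (top_true 5) ;; Pop 5) (Pop 5)) ;;
     Pop 10 ;; Set r (top_true 5) ;; transfer 6 5"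

lemma runs_read_pointer:
  assumes "r \<in> {8, 9}" "s 6 = []"
  shows "runs (read_pointer r) s (13 * length (s 10) + 4)
    (s(10 := after_pointer (s 10), r := wire (s 5) (pointer (s 10)) # tl (s r)))"
proof -
  have 1: "runs (While (top_true 10) (Pop 10 ;; If (nonempty 5) (Push 6 (top_true 5) ;; Pop 5) (Pop 5))) s
    (8 * length (s 10) + 1)
    (s(10 := dropWhile id (s 10), 5 := drop (pointer (s 10)) (s 5),
       6 := rev (take (pointer (s 10)) (s 5)) @ s 6))" for s
  proof (induction "s 10" arbitrary: s)
    case Nil
    then show ?case by (intro runs_mono[OF runs_While_False]) (auto simp: fun_eq_iff pointer_def)
  next
    case (Cons b y)
    show ?case
    proof (cases b)
      case False
      then show ?thesis
        by (intro runs_mono[OF runs_While_False]) (auto simp: fun_eq_iff pointer_def simp flip: Cons(2))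
    next
      case True
      let ?s = "s(10 := y, 5 := tl (s 5), 6 := take 1 (s 5) @ s 6)"
      have h1: "runs (While (top_true 10) (Pop 10 ;; If (nonempty 5) (Push 6 (top_true 5) ;; Pop 5) (Pop 5))) ?s
        (8 * length (?s 10) + 1)
        (?s(10 := dropWhile id (?s 10), 5 := drop (pointer (?s 10)) (?s 5),
           6 := rev (take (pointer (?s 10)) (?s 5)) @ ?s 6))"
        by (intro Cons.hyps) simp
      have move: "runs (If (nonempty 5) (Push 6 (top_true 5) ;; Pop 5) (Pop 5)) s (3 + 2)
          (s(5 := tl (s 5), 6 := take 1 (s 5) @ s 6))" for s
      proof (rule runs_If)
        assume "nonempty 5 (tops s)"
        then show "runs (Push 6 (top_true 5) ;; Pop 5) s 3 (s(5 := tl (s 5), 6 := take 1 (s 5) @ s 6))"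
          by (intro runs_mono[OF runs_Seq[OF runs_Push runs_Pop]]) (auto simp: fun_eq_iff neq_Nil_conv)
      next
        assume "\<not> nonempty 5 (tops s)"
        then show "runs (Pop 5) s 3 (s(5 := tl (s 5), 6 := take 1 (s 5) @ s 6))"
          by (intro runs_mono[OF runs_Pop]) (auto simp: fun_eq_iff)
      qed
      have h2: "runs (Pop 10 ;; If (nonempty 5) (Push 6 (top_true 5) ;; Pop 5) (Pop 5)) s 6 ?s"
        by (intro runs_mono[OF runs_Seq[OF runs_Pop move]]) (auto simp: fun_eq_iff simp flip: Cons(2))
      have h3: "top_true 10 (tops s)" using True by (auto simp flip: Cons(2))
      have "rev (take k (tl w)) @ take 1 w = rev (take (Suc k) w)" "drop k (tl w) = drop (Suc k) w"
        for k and w :: "bool list"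
        by (cases w; simp)+
      then show ?thesis using True
        by (intro runs_mono[OF runs_While_True[OF h3 h2 h1]])
          (auto simp: fun_eq_iff pointer_def simp flip: Cons(2) append_assoc)
    qed
  qed
  have "pointer (s 10) \<le> length (s 10)" by (simp add: pointer_def length_takeWhile_le)
  then show ?thesis unfolding read_pointer_def using assms
    by (intro runs_mono[OF runs_Seq[OF 1 runs_Seq[OF runs_Pop runs_Seq[OF runs_Set runs_transfer]]]])
      (auto simp: fun_eq_iff after_pointer_def wire_def hd_drop_conv_nth)
qed

definition after_gate :: "bool list \<Rightarrow> bool list" where
  "after_gate y = drop 4 (after_pointer (after_pointer y))"

definition gate_value :: "bool list \<Rightarrow> bool list \<Rightarrow> bool" where
  "gate_value y w = wire (after_pointer (after_pointer y))
     (2 * of_bool (wire w (pointer y)) + of_bool (wire w (pointer (after_pointer y))))"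

text \<open>Each of the four calls consumes one truth table bit, and only the call matching both
  operands pushes it. The order of the calls is the index \<open>2 p + q\<close> of
  \<open>gate_value\<close>.\<close>

definition select :: "bool \<Rightarrow> bool \<Rightarrow> prog" where
  "select p q = If (\<lambda>a. a 8 = Some p \<and> a 9 = Some q) (Push 5 (top_true 10) ;; Pop 10) (Pop 10)"

lemma runs_select:
  assumes "s 8 = [p']" "s 9 = [q']"
  shows "runs (select p q) s 5
    (s(10 := tl (s 10), 5 := (if p = p' \<and> q = q' then [wire (s 10) 0] else []) @ s 5))"
proof -
  have "runs (select p q) s (3 + 2)
    (s(10 := tl (s 10), 5 := (if p = p' \<and> q = q' then [wire (s 10) 0] else []) @ s 5))"
    unfolding select_def
  proof (rule runs_If)
    assume "tops s 8 = Some p \<and> tops s 9 = Some q"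
    then have "p = p'" "q = q'" using assms by (auto simp: tops_def)
    then show "runs (Push 5 (top_true 10) ;; Pop 10) s 3
        (s(10 := tl (s 10), 5 := (if p = p' \<and> q = q' then [wire (s 10) 0] else []) @ s 5))"
      by (intro runs_mono[OF runs_Seq[OF runs_Push runs_Pop]])
        (auto simp: fun_eq_iff wire_def hd_conv_nth)
  next
    assume "\<not> (tops s 8 = Some p \<and> tops s 9 = Some q)"
    then have "\<not> (p = p' \<and> q = q')" using assms by (auto simp: tops_def)
    then show "runs (Pop 10) s 3
        (s(10 := tl (s 10), 5 := (if p = p' \<and> q = q' then [wire (s 10) 0] else []) @ s 5))"
      by (intro runs_mono[OF runs_Pop]) (auto simp: fun_eq_iff)
  qed
  then show ?thesis by simp
qed

definition gate :: prog where
  "gate = read_pointer 8 ;; read_pointer 9 ;;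
     select False False ;; select False True ;; select True False ;; select True True ;;
     Pop 8 ;; Pop 9"

lemma length_after_pointer: "length (after_pointer y) \<le> length y - 1"
  using length_dropWhile_le[of id y] by (cases y) (auto simp: after_pointer_def)

text \<open>Even a malformed gate uses up a symbol of a nonempty certificate; this gives the
  termination of \<open>evaluate\<close> and \<open>gates\<close>.\<close>

lemma length_after_gate: "length (after_gate y) \<le> length y - 1"
  using length_after_pointer[of y] length_after_pointer[of "after_pointer y"]
  by (simp add: after_gate_def)

lemma tl_conv_drop: "tl w = drop 1 w"
  by (simp add: drop_Suc)

lemma wire_drop: "wire (drop n w) a = wire w (n + a)"
  by (auto simp: wire_def)

lemma runs_selects:
  assumes "s 8 = [p]" "s 9 = [q]"
  shows "runs (select False False ;; select False True ;; select True False ;; select True True ;; Pop 8 ;; Pop 9)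
    s 22 (s(10 := drop 4 (s 10), 5 := wire (s 10) (2 * of_bool p + of_bool q) # s 5, 8 := [], 9 := []))"
  by (rule runs_mono[OF runs_Seq[OF runs_select[of _ p q] runs_Seq[OF runs_select[of _ p q]
        runs_Seq[OF runs_select[of _ p q] runs_Seq[OF runs_select[of _ p q]
        runs_Seq[OF runs_Pop runs_Pop]]]]]])
    (use assms in \<open>simp_all add: tl_conv_drop wire_drop fun_eq_iff eval_nat_numeral\<close>)

lemma runs_gate:
  assumes "s 6 = []" "s 8 = []" "s 9 = []"
  shows "runs gate s (26 * length (s 10) + 30)
    (s(10 := after_gate (s 10), 5 := gate_value (s 10) (s 5) # s 5))"
proof -
  let ?y = "s 10" and ?w = "s 5"
  let ?p = "wire ?w (pointer ?y)" and ?q = "wire ?w (pointer (after_pointer ?y))"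
  define s' where "s' = s(10 := after_pointer (after_pointer ?y), 8 := [?p], 9 := [?q])"
  have "runs (read_pointer 9) (s(10 := after_pointer ?y, 8 := [?p])) (13 * length ?y + 4) s'"
    using assms length_after_pointer[of ?y]
    by (intro runs_mono[OF runs_read_pointer]) (auto simp: fun_eq_iff s'_def)
  moreover have "runs (read_pointer 8) s (13 * length ?y + 4) (s(10 := after_pointer ?y, 8 := [?p]))"
    using assms by (intro runs_mono[OF runs_read_pointer]) (auto simp: fun_eq_iff)
  moreover have "runs (select False False ;; select False True ;; select True False ;; select True True ;; Pop 8 ;; Pop 9)
      s' 22 (s(10 := after_gate ?y, 5 := gate_value ?y ?w # ?w))"
    using assms by (intro runs_mono[OF runs_selects[of _ ?p ?q]])
      (simp_all add: s'_def after_gate_def gate_value_def fun_eq_iff)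
  ultimately have "runs gate s ((13 * length ?y + 4) + ((13 * length ?y + 4) + 22))
      (s(10 := after_gate ?y, 5 := gate_value ?y ?w # ?w))"
    unfolding gate_def by (intro runs_Seq)
  then show ?thesis by (elim runs_mono) auto
qed

function evaluate :: "bool list \<Rightarrow> bool list \<Rightarrow> bool list" where
  "evaluate y w = (if y = [] then w else evaluate (after_gate y) (gate_value y w # w))"
  by auto
termination
  by (relation "measure (length \<circ> fst)")
    (auto intro: le_less_trans[OF length_after_gate])

declare evaluate.simps [simp del]

function gates :: "bool list \<Rightarrow> nat" where
  "gates y = (if y = [] then 0 else Suc (gates (after_gate y)))"
  by auto
termination
  by (relation "measure length") (auto intro: le_less_trans[OF length_after_gate])

declare gates.simps [simp del]

text \<open>The bound \<open>n\<close> stays fixed while the certificate shrinks, so that every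
  round has the same cost in the induction.\<close>

lemma runs_evaluate:
  assumes "s 6 = []" "s 8 = []" "s 9 = []" "length (s 10) \<le> n"
  shows "runs (While (nonempty 10) gate) s (length (s 10) * (26 * n + 32) + 1)
    (s(10 := [], 5 := evaluate (s 10) (s 5)))"
  using assms
proof (induction "s 10" "s 5" arbitrary: s rule: evaluate.induct)
  case 1
  show ?case
  proof (cases "s 10 = []")
    case True
    then show ?thesis
      by (intro runs_mono[OF runs_While_False]) (auto simp: fun_eq_iff evaluate.simps[of "[]"])
  next
    case False
    let ?s = "s(10 := after_gate (s 10), 5 := gate_value (s 10) (s 5) # s 5)"
    have len: "Suc (length (after_gate (s 10))) \<le> length (s 10)"
      using False length_after_gate[of "s 10"] by (cases "s 10") auto
    have h1: "runs (While (nonempty 10) gate) ?s (length (?s 10) * (26 * n + 32) + 1)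
        (?s(10 := [], 5 := evaluate (?s 10) (?s 5)))"
      by (rule 1(1)) (use False 1(2-) len in auto)
    have h2: "runs gate s (26 * n + 30) ?s"
      using 1(2-) by (intro runs_mono[OF runs_gate]) auto
    have h3: "nonempty 10 (tops s)" using False by simp
    show ?thesis using False mult_le_mono1[OF len, of "26 * n + 32"]
      by (intro runs_mono[OF runs_While_True[OF h3 h2 h1]])
        (auto simp: fun_eq_iff evaluate.simps[of "s 10"])
  qed
qed

definition charge :: prog where
  "charge = While (nonempty 11) (Push 7 (top_true 11) ;; Pop 11 ;; Pop 3 ;; Pop 3) ;; transfer 7 11"

lemma runs_charge:
  assumes "s 7 = []"
  shows "runs charge s (12 * length (s 11) + 2) (s(3 := drop (2 * length (s 11)) (s 3)))"
proof -
  have 1: "runs (While (nonempty 11) (Push 7 (top_true 11) ;; Pop 11 ;; Pop 3 ;; Pop 3)) s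
      (7 * length (s 11) + 1)
      (s(11 := [], 7 := rev (s 11) @ s 7, 3 := drop (2 * length (s 11)) (s 3)))" for s
  proof (induction "s 11" arbitrary: s)
    case Nil
    then show ?case by (intro runs_mono[OF runs_While_False]) (auto simp: fun_eq_iff)
  next
    case (Cons b w)
    let ?s = "s(11 := w, 7 := b # s 7, 3 := drop 2 (s 3))"
    have drop2: "drop 2 z = tl (tl z)" for z :: "bool list" by (simp add: numeral_2_eq_2 drop_Suc)
    have h1: "runs (While (nonempty 11) (Push 7 (top_true 11) ;; Pop 11 ;; Pop 3 ;; Pop 3)) ?s
      (7 * length (?s 11) + 1)
      (?s(11 := [], 7 := rev (?s 11) @ ?s 7, 3 := drop (2 * length (?s 11)) (?s 3)))"
      by (intro Cons.hyps) simp
    have h2: "runs (Push 7 (top_true 11) ;; Pop 11 ;; Pop 3 ;; Pop 3) s 5 ?s"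
      by (intro runs_mono[OF runs_Seq[OF runs_Push runs_Seq[OF runs_Pop runs_Seq[OF runs_Pop runs_Pop]]]])
        (auto simp: fun_eq_iff drop2 simp flip: Cons(2))
    have h3: "nonempty 11 (tops s)" by (auto simp flip: Cons(2))
    show ?case
      by (intro runs_mono[OF runs_While_True[OF h3 h2 h1]])
        (auto simp: fun_eq_iff add_ac simp flip: Cons(2))
  qed
  show ?thesis unfolding charge_def using assms
    by (intro runs_mono[OF runs_Seq[OF 1 runs_transfer]]) (auto simp: fun_eq_iff)
qed

fun pops :: "nat \<Rightarrow> prog" where
  "pops 0 = Pop 3"
| "pops (Suc n) = Pop 3 ;; pops n"

lemma runs_pops: "runs (pops n) s (Suc n) (s(3 := drop (Suc n) (s 3)))"
proof (induction n arbitrary: s)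
  case 0
  show ?case unfolding pops.simps by (rule runs_mono[OF runs_Pop]) (auto simp: drop_Suc)
next
  case (Suc n)
  show ?case unfolding pops.simps
    by (intro runs_mono[OF runs_Seq[OF runs_Pop Suc]]) (auto simp: drop_Suc)
qed

text \<open>The cost of \<open>k\<close> gates is \<open>2 log k! + O(k)\<close>, which bounds \<open>k\<close> by about
  \<open>2\<^sup>n / (n - log n + O(1))\<close> on strings of length \<open>2\<^bsup>n+1\<^esup> - 1\<close>. The constant 40 pays for the
  exponential factors of the counting argument.\<close>

definition cost :: "nat \<Rightarrow> nat" where
  "cost k = (\<Sum>i<k. 2 * length (std_enum i) + 40)"

definition size_check :: prog where
  "size_check = While (nonempty 10)
     (gate ;; charge ;; pops 39 ;; increment 11 7 8 ;; Pop 8)"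

lemma runs_size_check:
  assumes "s 6 = []" "s 7 = []" "s 8 = []" "s 9 = []"
    and "s 11 = rev (std_enum i)" "length (s 10) \<le> m" "i + length (s 10) \<le> n"
    and "s 3 = drop (cost i) z"
  shows "runs size_check s (length (s 10) * (26 * m + 22 * n + 82) + 1)
    (s(10 := [], 5 := evaluate (s 10) (s 5), 11 := rev (std_enum (i + gates (s 10))),
       3 := drop (cost (i + gates (s 10))) z))"
  using assms
proof (induction "s 10" "s 5" arbitrary: s i rule: evaluate.induct)
  case 1
  show ?case
  proof (cases "s 10 = []")
    case True
    then show ?thesis unfolding size_check_def using 1(2-)
      by (intro runs_mono[OF runs_While_False]) (auto simp: fun_eq_iff evaluate.simps[of "[]"] gates.simps[of "[]"])
  next
    case False
    let ?s = "s(10 := after_gate (s 10), 5 := gate_value (s 10) (s 5) # s 5, 11 := rev (std_enum (Suc i)),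
      3 := drop (cost (Suc i)) z)"
    have len: "Suc (length (after_gate (s 10))) \<le> length (s 10)"
      using False length_after_gate[of "s 10"] by (cases "s 10") auto
    have h1: "runs size_check ?s (length (?s 10) * (26 * m + 22 * n + 82) + 1)
      (?s(10 := [], 5 := evaluate (?s 10) (?s 5), 11 := rev (std_enum (Suc i + gates (?s 10))),
       3 := drop (cost (Suc i + gates (?s 10))) z))"
      by (rule 1(1)) (use False 1(2-) len in auto)
    have "length (std_enum i) \<le> n" using length_std_enum_le[of i] 1(2-) by linarith
    then have h2: "runs (gate ;; charge ;; pops 39 ;; increment 11 7 8 ;; Pop 8) s (26 * m + 22 * n + 80) ?s"
      using 1(2-)
      by (intro runs_mono[OF runs_Seq[OF runs_gate runs_Seq[OF runs_charge runs_Seq[OF runs_pops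
              runs_Seq[OF runs_increment runs_Pop]]]]])
        (auto simp: fun_eq_iff incr_rev_std_enum cost_def add_ac simp del: std_enum.simps)
    have h3: "nonempty 10 (tops s)" using False by simp
    show ?thesis using False mult_le_mono1[OF len, of "26 * m + 22 * n + 82"] unfolding size_check_def
      by (intro runs_mono[OF runs_While_True[OF h3 h2 h1[unfolded size_check_def]]])
        (auto simp: fun_eq_iff evaluate.simps[of "s 10"] gates.simps[of "s 10"])
  qed
qed

section \<open>Comparing the circuit with the truth table\<close>

definition circuit_output :: "bool list \<Rightarrow> bool list \<Rightarrow> bool" where
  "circuit_output y u = wire (evaluate y (rev u)) 0"

text \<open>Overflow means that \<open>std_enum j\<close> is the first word of its length. There the flag
  \<open>consistent\<close> forgets all earlier mismatches, so that in the end it refers to the inputs of the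
  last length only, and the verifier need not know that length.\<close>

fun overflow :: "nat \<Rightarrow> bool" where
  "overflow 0 = True"
| "overflow (Suc j) = (\<forall>b\<in>set (std_enum j). b)"

fun consistent :: "bool list \<Rightarrow> bool list \<Rightarrow> nat \<Rightarrow> bool" where
  "consistent x y 0 = False"
| "consistent x y (Suc j) \<longleftrightarrow>
     (overflow j \<or> consistent x y j) \<and> circuit_output y (std_enum j) = x ! j"

definition verifier_step :: prog where
  "verifier_step = copy 4 5 7 ;; copy 2 10 7 ;; While (nonempty 10) gate ;;
     Set 13 (\<lambda>a. (top_true 12 a \<or> top_true 13 a) \<and> top_true 5 a = top_true 1 a) ;;
     clear 5 ;; Pop 1 ;; increment 4 7 12"

lemma length_evaluate: "length (evaluate y w) \<le> length y + length w"
proof (induction y w rule: evaluate.induct)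
  case (1 y w)
  show ?case
  proof (cases "y = []")
    case False
    then show ?thesis using 1 length_after_gate[of y]
      by (subst evaluate.simps) (cases y; auto)
  qed (simp add: evaluate.simps)
qed

text \<open>At \<open>j = 0\<close> stack 13 is empty and reads as \<open>False\<close>, in
  accordance with \<open>consistent x y 0\<close>. Flag 12 is read before \<open>increment\<close>
  replaces it, so step \<open>j\<close> sees \<open>overflow j\<close>.\<close>

lemma runs_verifier_step:
  assumes s: "\<And>i. i \<in> {5, 6, 7, 8, 9, 10} \<Longrightarrow> s i = []"
    and "s 1 = drop j x" "s 2 = y" "s 4 = rev (std_enum j)" "s 12 = [overflow j]"
    and "s 13 = (if j = 0 then [] else [consistent x y j])" "j < length x" "length x + length y \<le> n"
  shows "runs verifier_step s (30 * n * n + 80 * n + 20)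
    (s(1 := drop (Suc j) x, 4 := rev (std_enum (Suc j)), 12 := [overflow (Suc j)],
       13 := [consistent x y (Suc j)]))"
proof -
  have j: "length (std_enum j) \<le> n" "length y \<le> n"
    using length_std_enum_le[of j] assms by linarith+
  have y: "length y * (26 * n + 32) \<le> n * (26 * n + 32)" using j by (intro mult_mono) auto
  have e: "length (evaluate y (rev (std_enum j))) \<le> 2 * n"
    using length_evaluate[of y "rev (std_enum j)"] j by simp
  let ?s1 = "s(5 := rev (std_enum j))"
  have 1: "runs (copy 4 5 7) s (12 * n + 2) ?s1"
    using assms j by (intro runs_mono[OF runs_copy]) auto
  let ?s2 = "?s1(10 := y)"
  have 2: "runs (copy 2 10 7) ?s1 (12 * n + 2) ?s2"
    using assms j by (intro runs_mono[OF runs_copy]) auto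
  let ?s3 = "s(5 := evaluate y (rev (std_enum j)))"
  have 3: "runs (While (nonempty 10) gate) ?s2 (n * (26 * n + 32) + 1) ?s3"
    using s y j by (intro runs_mono[OF runs_evaluate[where n = n]]) (auto simp: fun_eq_iff)
  let ?s4 = "?s3(13 := [consistent x y (Suc j)])"
  have x: "drop j x \<noteq> []" "hd (drop j x) = x ! j"
    using \<open>j < length x\<close> by (auto simp: hd_drop_conv_nth)
  have w: "w \<noteq> [] \<and> hd w \<longleftrightarrow> wire w 0" "wire [b] 0 = b" for w b
    by (auto simp: wire_def hd_conv_nth)
  have 4: "runs (Set 13 (\<lambda>a. (top_true 12 a \<or> top_true 13 a) \<and> top_true 5 a = top_true 1 a))
      ?s3 1 ?s4"
    by (rule runs_mono[OF runs_Set]) (use assms(2-6) x in \<open>simp_all add: w circuit_output_def\<close>)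
  let ?s5 = "s(13 := [consistent x y (Suc j)])"
  have 5: "runs (clear 5) ?s4 (6 * n + 1) ?s5"
    by (rule runs_mono[OF runs_clear]) (use s e in \<open>simp_all add: fun_eq_iff\<close>)
  have 6: "runs (Pop 1) ?s5 1 (?s5(1 := drop (Suc j) x))"
    by (rule runs_mono[OF runs_Pop]) (use assms in \<open>simp_all add: drop_Suc tl_drop\<close>)
  have 7: "runs (increment 4 7 12) (?s5(1 := drop (Suc j) x)) (10 * n + 7)
    (s(1 := drop (Suc j) x, 4 := rev (std_enum (Suc j)), 12 := [overflow (Suc j)],
       13 := [consistent x y (Suc j)]))"
    by (rule runs_mono[OF runs_increment])
      (use assms j in \<open>simp_all add: fun_eq_iff incr_rev_std_enum del: std_enum.simps\<close>)
  show ?thesis unfolding verifier_step_def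
    by (rule runs_mono[OF runs_Seq[OF 1 runs_Seq[OF 2 runs_Seq[OF 3 runs_Seq[OF 4
      runs_Seq[OF 5 runs_Seq[OF 6 7]]]]]] refl]) (simp add: algebra_simps)
qed

definition verifier :: prog where
  "verifier = copy 1 3 7 ;; copy 2 10 7 ;; size_check ;; clear 5 ;; Set 12 (\<lambda>_. True) ;;
     While (nonempty 1) verifier_step ;;
     Emit (\<lambda>a. nonempty 3 a \<and> top_true 12 a \<and> top_true 13 a)"

definition accepts :: "bool list \<Rightarrow> bool list \<Rightarrow> bool" where
  "accepts x y \<longleftrightarrow> cost (gates y) < length x \<and> overflow (length x) \<and> consistent x y (length x)"

lemma polytime_accepts: "polytime (\<lambda>(x, y). [x, y]) (\<lambda>(x, y). [accepts x y])"
proof (rule polytimeI)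
  fix a :: "bool list \<times> bool list"
  obtain x y where a: "a = (x, y)" by force
  define n where "n = length x + length y"
  let ?init = "input_stacks [x, y]"
  have s0: "?init i = (if i = 1 then x else if i = 2 then y else [])" for i
    by (auto simp: input_stacks_def nth_Cons split: nat.split)
  let ?s1 = "?init(3 := x)"
  have 1: "runs (copy 1 3 7) ?init (12 * n + 2) ?s1"
    by (rule runs_mono[OF runs_copy]) (simp_all add: s0 n_def)
  let ?s2 = "?s1(10 := y)"
  have 2: "runs (copy 2 10 7) ?s1 (12 * n + 2) ?s2"
    by (rule runs_mono[OF runs_copy]) (simp_all add: s0 n_def)
  let ?s = "?init(3 := drop (cost (gates y)) x, 11 := rev (std_enum (gates y)))"
  let ?s3 = "?s(5 := evaluate y [])"
  have y: "length y * (26 * n + 22 * n + 82) \<le> n * (48 * n + 82)" by (intro mult_mono) (auto simp: n_def)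
  have 3: "runs size_check ?s2 (n * (48 * n + 82) + 1) ?s3"
    by (rule runs_mono[OF runs_size_check[where i = 0 and m = n and n = n and z = x]])
      (use y in \<open>auto simp: s0 n_def cost_def fun_eq_iff\<close>)
  have 4: "runs (clear 5) ?s3 (3 * n + 1) ?s"
    by (rule runs_mono[OF runs_clear]) (use length_evaluate[of y "[]"] in \<open>auto simp: s0 n_def fun_eq_iff\<close>)
  have 5: "runs (Set 12 (\<lambda>_. True)) ?s 1 (?s(12 := [True]))"
    by (rule runs_mono[OF runs_Set]) (simp_all add: s0)
  define st where "st j = ?s(1 := drop j x, 4 := rev (std_enum j), 12 := [overflow j],
       13 := (if j = 0 then [] else [consistent x y j]))" for j
  have "runs verifier_step (st j) (30 * n * n + 80 * n + 20) (st (Suc j))" if "j < length x" for j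
    by (rule runs_mono[OF runs_verifier_step[where j = j and x = x and y = y and n = n]])
      (use that in \<open>auto simp: st_def s0 n_def fun_eq_iff simp del: std_enum.simps\<close>)
  moreover have "nonempty 1 (tops (st j)) \<longleftrightarrow> j < length x" for j
    by (auto simp: st_def)
  ultimately have "runs (While (nonempty 1) verifier_step) (st 0)
      (length x * (30 * n * n + 80 * n + 20 + 2) + 1) (st (length x))"
    by (intro runs_While) auto
  moreover have "st 0 = ?s(12 := [True])" by (simp add: st_def s0 fun_eq_iff)
  moreover have "length x * (30 * n * n + 80 * n + 20 + 2) \<le> n * (30 * n * n + 80 * n + 22)"
    by (intro mult_mono) (auto simp: n_def)
  ultimately have 6: "runs (While (nonempty 1) verifier_step) (?s(12 := [True]))
      (n * (30 * n * n + 80 * n + 22) + 1) (st (length x))"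
    by (auto elim!: runs_mono)
  have 7: "runs (Emit (\<lambda>a. nonempty 3 a \<and> top_true 12 a \<and> top_true 13 a)) (st (length x)) 1
      ((st (length x))(0 := [accepts x y]))"
    by (rule runs_mono[OF runs_Emit]) (auto simp: st_def s0 accepts_def not_le)
  \<comment> \<open>The cubic term comes from evaluating the whole certificate, at quadratic cost,
    once for each symbol of the string.\<close>
  have "runs verifier ?init (poly [:9, 131, 128, 30:] n) ((st (length x))(0 := [accepts x y]))"
    unfolding verifier_def
    by (rule runs_mono[OF runs_Seq[OF 1 runs_Seq[OF 2 runs_Seq[OF 3 runs_Seq[OF 4
      runs_Seq[OF 5 runs_Seq[OF 6 7]]]]]] refl]) (simp add: algebra_simps)
  then show "\<exists>s. runs verifier (input_stacks (case a of (x, y) \<Rightarrow> [x, y]))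
      (poly [:9, 131, 128, 30:] (sum_list (map length (case a of (x, y) \<Rightarrow> [x, y])))) s \<and>
      s 0 = (case a of (x, y) \<Rightarrow> [accepts x y])"
    by (intro exI[of _ "(st (length x))(0 := [accepts x y])"]) (simp add: a n_def)
qed

section \<open>Counting small circuits\<close>

lemma power2_less_iff: "(2::nat) ^ a < 2 ^ b \<longleftrightarrow> a < b"
  by simp

text \<open>This identifies the integer logarithm behind \<open>cost\<close> and
  \<open>twice_log\<close>: the floor of \<open>log 2 (n + 1)\<close>.\<close>

lemma length_std_enum: "2 ^ length (std_enum n) \<le> Suc n \<and> Suc n < 2 * 2 ^ length (std_enum n)"
  by (induction n rule: std_enum.induct) auto

lemma length_std_enum_eq_iff: "length (std_enum j) = n \<longleftrightarrow> 2 ^ n \<le> Suc j \<and> Suc j < 2 ^ Suc n"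
proof
  assume "2 ^ n \<le> Suc j \<and> Suc j < 2 ^ Suc n"
  then have "2 ^ n < (2::nat) ^ Suc (length (std_enum j))" "2 ^ length (std_enum j) < (2::nat) ^ Suc n"
    using length_std_enum[of j] by (auto intro: le_less_trans)
  then show "length (std_enum j) = n" unfolding power2_less_iff by simp
qed (use length_std_enum in auto)

lemma length_std_enum_mono: "i \<le> j \<Longrightarrow> length (std_enum i) \<le> length (std_enum j)"
  using std_enum_strict_mono[of i j] by (cases "i = j") (auto simp: lenlex_conv)

lemma length_std_enum_Suc:
  "length (std_enum (Suc j)) = length (std_enum j) + (if overflow (Suc j) then 1 else 0)"
  using length_incr[of "rev (std_enum j)"] by (simp only: incr_rev_std_enum) simp

text \<open>At an overflow no earlier word has the current length, so the conjunction restarts;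
  elsewhere it gains one conjunct.\<close>

lemma consistent_Suc_iff:
  "consistent x y (Suc i) \<longleftrightarrow>
     (\<forall>j\<le>i. length (std_enum j) = length (std_enum i) \<longrightarrow> circuit_output y (std_enum j) = x ! j)"
proof (induction i)
  case 0
  show ?case by simp
next
  case (Suc i)
  show ?case
  proof (cases "overflow (Suc i)")
    case True
    then have "length (std_enum (Suc i)) = Suc (length (std_enum i))" by (simp only: length_std_enum_Suc) simp
    moreover have "length (std_enum j) \<noteq> Suc (length (std_enum i))" if "j \<le> i" for j
      using length_std_enum_mono[OF that] by simp
    ultimately have "(\<forall>j\<le>Suc i. length (std_enum j) = length (std_enum (Suc i)) \<longrightarrow>
        circuit_output y (std_enum j) = x ! j) \<longleftrightarrow> circuit_output y (std_enum (Suc i)) = x ! Suc i"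
      by (auto simp: le_Suc_eq simp del: std_enum.simps)
    then show ?thesis using True by (simp del: overflow.simps std_enum.simps)
  next
    case False
    then have "length (std_enum (Suc i)) = length (std_enum i)" by (simp only: length_std_enum_Suc) simp
    then show ?thesis using False Suc
      by (auto simp: le_Suc_eq simp del: overflow.simps std_enum.simps consistent.simps
          simp: consistent.simps(2)[of x y "Suc i"])
  qed
qed

text \<open>There are \<open>2^(n+1) - 1\<close> words of length at most \<open>n\<close>, so
  \<open>x\<close> has that length exactly if \<open>length x\<close> is the index of the first word
  of length \<open>n + 1\<close>, that is, an overflow.\<close>

lemma accepts_iff:
  "accepts x y \<longleftrightarrow> cost (gates y) < length x \<and>
     (\<exists>n. length x = 2 ^ Suc n - 1 \<and>
       (\<forall>j<length x. length (std_enum j) = n \<longrightarrow> circuit_output y (std_enum j) = x ! j))"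
proof (cases "length x")
  case 0
  have "2 ^ Suc n - 1 \<noteq> (0::nat)" for n using one_less_power[of "2::nat" "Suc n"] by linarith
  with 0 show ?thesis by (auto simp: accepts_def)
next
  case (Suc i)
  have c: "consistent x y (length x) \<longleftrightarrow>
     (\<forall>j<length x. length (std_enum j) = length (std_enum i) \<longrightarrow> circuit_output y (std_enum j) = x ! j)"
    unfolding Suc consistent_Suc_iff by (auto simp: less_Suc_eq_le)
  have "overflow (Suc i) \<longleftrightarrow> Suc i = 2 ^ Suc (length (std_enum i)) - 1"
  proof
    assume "overflow (Suc i)"
    then have "length (std_enum (Suc i)) = Suc (length (std_enum i))" by (simp only: length_std_enum_Suc) simp
    then show "Suc i = 2 ^ Suc (length (std_enum i)) - 1"
      using length_std_enum[of "Suc i"] length_std_enum[of i] by (simp del: std_enum.simps)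
  next
    assume i: "Suc i = 2 ^ Suc (length (std_enum i)) - 1"
    then have "2 ^ Suc (length (std_enum i)) < (2::nat) ^ Suc (length (std_enum (Suc i)))"
      using length_std_enum[of "Suc i"] by (simp del: std_enum.simps)
    then have "length (std_enum i) < length (std_enum (Suc i))"
      unfolding power2_less_iff by simp
    then show "overflow (Suc i)"
      using length_std_enum_Suc[of i] by (auto simp del: std_enum.simps overflow.simps split: if_splits)
  qed
  moreover have "n = length (std_enum i)" if "Suc i = 2 ^ Suc n - 1" for n
  proof -
    have "1 \<le> (2::nat) ^ n" by simp
    then have "2 ^ n \<le> Suc i \<and> Suc i < 2 ^ Suc n" using that unfolding power_Suc by linarith
    then show ?thesis using length_std_enum_eq_iff by metis
  qed
  ultimately show ?thesis unfolding accepts_def c unfolding Suc by metis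
qed

text \<open>An encoded circuit is counted through the set of functions computed at its gates, where a
  pointer beyond the first input reads \<open>False\<close>.\<close>

type_synonym bfun = "bool list \<Rightarrow> bool"

text \<open>Cutting off at length \<open>n\<close>, here and in \<open>gate_fun\<close>, turns
  agreement on inputs of length \<open>n\<close> into equality of functions and leaves only finitely
  many of them.\<close>

definition input_fun :: "nat \<Rightarrow> nat \<Rightarrow> bfun" where
  "input_fun n j = (\<lambda>u. length u = n \<and> u ! j)"

definition base_list :: "nat \<Rightarrow> bfun list" where
  "base_list n = (\<lambda>_. False) # map (input_fun n) [0..<n]"

definition base :: "nat \<Rightarrow> bfun set" where
  "base n = set (base_list n)"

definition gate_fun :: "nat \<Rightarrow> (bool \<Rightarrow> bool \<Rightarrow> bool) \<Rightarrow> bfun \<Rightarrow> bfun \<Rightarrow> bfun" where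
  "gate_fun n g p q = (\<lambda>u. length u = n \<and> g (p u) (q u))"

text \<open>Order and repetitions are forgotten, so a chain may have fewer elements than the circuit
  has gates.\<close>

inductive chain :: "nat \<Rightarrow> bfun set \<Rightarrow> bool" for n where
  empty: "chain n {}"
| insert: "chain n S \<Longrightarrow> p \<in> base n \<union> S \<Longrightarrow> q \<in> base n \<union> S \<Longrightarrow> chain n (insert (gate_fun n g p q) S)"

lemma finite_chain: "chain n S \<Longrightarrow> finite S"
  by (induction rule: chain.induct) auto

text \<open>Symbolic evaluation: wires carry functions of the input instead of bits, so one chain
  serves all inputs of length \<open>n\<close>.\<close>

lemma evaluate_chain:
  assumes "chain n S" "set ws \<subseteq> base n \<union> S"
  shows "\<exists>S' ws'. chain n S' \<and> set ws' \<subseteq> base n \<union> S' \<and> card S' \<le> card S + gates y \<and>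
    (\<forall>u. length u = n \<longrightarrow> evaluate y (map (\<lambda>f. f u) ws) = map (\<lambda>f. f u) ws')"
  using assms
proof (induction y arbitrary: S ws rule: gates.induct)
  case (1 y)
  show ?case
  proof (cases "y = []")
    case True
    then have "\<forall>u. length u = n \<longrightarrow> evaluate y (map (\<lambda>f. f u) ws) = map (\<lambda>f. f u) ws"
      by (simp add: evaluate.simps)
    with 1(2,3) show ?thesis by (metis le_add1)
  next
    case False
    define ref :: "nat \<Rightarrow> bfun" where "ref a = (if a < length ws then ws ! a else (\<lambda>_. False))" for a
    let ?y = "after_pointer y"
    define g where "g a b = wire (after_pointer ?y) (2 * of_bool a + of_bool b)" for a b
    define f where "f = gate_fun n g (ref (pointer y)) (ref (pointer ?y))"
    have ref: "ref a \<in> base n \<union> S" for a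
    proof (cases "a < length ws")
      case True
      then have "ws ! a \<in> set ws" by simp
      then show ?thesis using 1(3) True unfolding ref_def by (simp add: subset_iff)
    qed (simp add: ref_def base_def base_list_def)
    then have "chain n (insert f S)" unfolding f_def using 1(2) by (intro chain.insert)
    moreover have "set (f # ws) \<subseteq> base n \<union> insert f S" using 1(3) by auto
    ultimately obtain S' ws' where S': "chain n S'" "set ws' \<subseteq> base n \<union> S'"
      "card S' \<le> card (insert f S) + gates (after_gate y)"
      "\<And>u. length u = n \<Longrightarrow> evaluate (after_gate y) (map (\<lambda>f. f u) (f # ws)) = map (\<lambda>f. f u) ws'"
      using 1(1)[OF False] by blast
    have "wire (map (\<lambda>f. f u) ws) a = ref a u" for u a
      by (simp add: wire_def ref_def)
    then have "gate_value y (map (\<lambda>f. f u) ws) = f u" if "length u = n" for u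
      using that by (simp add: gate_value_def f_def gate_fun_def g_def)
    then have "evaluate y (map (\<lambda>f. f u) ws) = map (\<lambda>f. f u) ws'" if "length u = n" for u
      using that S'(4)[of u] False by (simp add: evaluate.simps[of y])
    moreover have "card S' \<le> card S + gates y"
      using S'(3) card_insert_le_m1[of "Suc (card S)" S f] False by (simp add: gates.simps[of y])
    ultimately show ?thesis using S' by blast
  qed
qed

lemma map_input_funs: "length u = n \<Longrightarrow> map (\<lambda>f. f u) (rev (map (input_fun n) [0..<n])) = rev u"
proof -
  assume "length u = n"
  then have "map (\<lambda>j. input_fun n j u) [0..<n] = u"
    by (intro nth_equalityI) (simp_all add: input_fun_def)
  moreover have "map (\<lambda>f. f u) (rev (map (input_fun n) [0..<n])) = rev (map (\<lambda>j. input_fun n j u) [0..<n])"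
    by (simp add: rev_map comp_def)
  ultimately show ?thesis by metis
qed

lemma circuit_output_chain:
  "\<exists>S. chain n S \<and> card S \<le> gates y \<and> (\<exists>h\<in>base n \<union> S. \<forall>u. length u = n \<longrightarrow> circuit_output y u = h u)"
proof -
  define ws0 where "ws0 = rev (map (input_fun n) [0..<n])"
  have "set ws0 \<subseteq> base n \<union> {}" by (auto simp: base_def base_list_def ws0_def)
  from evaluate_chain[OF chain.empty this, of y] obtain S ws where S:
    "chain n S" "set ws \<subseteq> base n \<union> S" "card S \<le> card ({} :: bfun set) + gates y"
    "\<And>u. length u = n \<Longrightarrow> evaluate y (map (\<lambda>f. f u) ws0) = map (\<lambda>f. f u) ws"
    by blast
  have out: "circuit_output y u = wire (map (\<lambda>f. f u) ws) 0" if "length u = n" for u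
    using S(4)[OF that] map_input_funs[OF that] unfolding circuit_output_def ws0_def by metis
  show ?thesis
  proof (cases ws)
    case Nil
    have "(\<lambda>_. False) \<in> base n \<union> S" by (simp add: base_def base_list_def)
    moreover have "\<forall>u. length u = n \<longrightarrow> circuit_output y u = (\<lambda>_. False) u"
      using out by (simp add: wire_def Nil)
    ultimately show ?thesis using S(1,3) by (metis add_0 card.empty)
  next
    case (Cons h ws')
    then have "h \<in> base n \<union> S" "\<forall>u. length u = n \<longrightarrow> circuit_output y u = h u"
      using S(2) out by (simp_all add: wire_def Cons)
    then show ?thesis using S(1,3) by (metis add_0 card.empty)
  qed
qed

text \<open>The last conjunct says that the defining equations of a chain have a unique solution. Hence a
  numbering of the chain is determined by the equations written in terms of the numbers, and
  all \<open>k!\<close> numberings of a chain of \<open>k\<close> functions have different descriptions.\<close>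

lemma chain_equations:
  assumes "chain n S"
  shows "\<exists>c. (\<forall>f\<in>S. case c f of (g, p, q) \<Rightarrow> p \<in> base n \<union> S \<and> q \<in> base n \<union> S \<and> f = gate_fun n g p q) \<and>
    (\<forall>\<phi>. (\<forall>f\<in>S. case c f of (g, p, q) \<Rightarrow>
        \<phi> f = gate_fun n g (if p \<in> base n then p else \<phi> p) (if q \<in> base n then q else \<phi> q)) \<longrightarrow>
      (\<forall>f\<in>S. \<phi> f = f))"
    (is "\<exists>c. ?P S c \<and> (\<forall>\<phi>. ?E S c \<phi> \<longrightarrow> _)")
  using assms
proof (induction rule: chain.induct)
  case empty
  show ?case by simp
next
  case (insert S p q g)
  let ?f = "gate_fun n g p q"
  show ?case
  proof (cases "?f \<in> S")
    \<comment> \<open>A function already present keeps its old equation; the new one might be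
      circular, as \<open>p\<close> or \<open>q\<close> may have been built from it.\<close>
    case True
    then show ?thesis using insert.IH by (simp add: insert_absorb)
  next
    case False
    from insert.IH obtain c where c: "?P S c" "\<And>\<phi>. ?E S c \<phi> \<Longrightarrow> \<forall>f\<in>S. \<phi> f = f" by blast
    let ?c = "c(?f := (g, p, q))"
    have "?P (insert ?f S) ?c"
    proof
      fix f assume "f \<in> insert ?f S"
      then consider "f = ?f" | "f \<in> S" "f \<noteq> ?f" by blast
      then show "case ?c f of (g, p, q) \<Rightarrow>
        p \<in> base n \<union> insert ?f S \<and> q \<in> base n \<union> insert ?f S \<and> f = gate_fun n g p q"
      proof cases
        case 1
        then show ?thesis using insert.hyps by auto
      next
        case 2
        have "case c f of (g, p, q) \<Rightarrow> p \<in> base n \<union> S \<and> q \<in> base n \<union> S \<and> f = gate_fun n g p q"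
          by (rule bspec[OF c(1) 2(1)])
        then show ?thesis using 2(2) by (simp split: prod.splits)
      qed
    qed
    moreover have "\<forall>f\<in>insert ?f S. \<phi> f = f" if E: "?E (insert ?f S) ?c \<phi>" for \<phi>
    proof -
      have "?E S c \<phi>"
      proof
        fix f assume "f \<in> S"
        with False have "?c f = c f" by auto
        moreover have "case ?c f of (g, p, q) \<Rightarrow>
          \<phi> f = gate_fun n g (if p \<in> base n then p else \<phi> p) (if q \<in> base n then q else \<phi> q)"
          by (rule bspec[OF E insertI2[OF \<open>f \<in> S\<close>]])
        ultimately show "case c f of (g, p, q) \<Rightarrow>
          \<phi> f = gate_fun n g (if p \<in> base n then p else \<phi> p) (if q \<in> base n then q else \<phi> q)"
          by simp
      qed
      then have S: "\<forall>f\<in>S. \<phi> f = f" by (rule c(2))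
      have "\<phi> ?f = gate_fun n g (if p \<in> base n then p else \<phi> p) (if q \<in> base n then q else \<phi> q)"
        using E by simp
      \<comment> \<open>The operands lie in the base or in \<open>S\<close>, where
        \<open>\<phi>\<close> is already the identity.\<close>
      then have "\<phi> ?f = ?f" using S insert.hyps by auto
      with S show ?thesis by simp
    qed
    ultimately show ?thesis by blast
  qed
qed

lemma card_chain_numberings:
  "card {xs. distinct xs \<and> length xs = k \<and> chain n (set xs)} \<le> (16 * (n + 1 + k)\<^sup>2) ^ k"
proof -
  define bs where "bs = base_list n"
  have bs: "set bs = base n" "length bs = n + 1" by (simp_all add: bs_def base_def base_list_def)
  define X where "X = {xs. distinct xs \<and> length xs = k \<and> chain n (set xs)}"
  define D where "D = {d :: ((bool \<Rightarrow> bool \<Rightarrow> bool) \<times> nat \<times> nat) list.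
    set d \<subseteq> UNIV \<times> {..<n + 1 + k} \<times> {..<n + 1 + k} \<and> length d = k}"
  define solves where "solves d zs \<longleftrightarrow> length zs = k \<and> (\<forall>i<k. case d ! i of (g, a, b) \<Rightarrow>
      zs ! i = gate_fun n g ((bs @ zs) ! a) ((bs @ zs) ! b))" for d and zs :: "bfun list"
  have "\<exists>d. d \<in> D \<and> solves d xs \<and> (\<forall>zs. solves d zs \<longrightarrow> zs = xs)" if "xs \<in> X" for xs
  proof -
    have xs: "distinct xs" "length xs = k" "chain n (set xs)" using that by (auto simp: X_def)
    define eqs where "eqs c \<phi> \<longleftrightarrow> (\<forall>f\<in>set xs. case c f of (g, p, q) \<Rightarrow>
        \<phi> f = gate_fun n g (if p \<in> base n then p else \<phi> p) (if q \<in> base n then q else \<phi> q))"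
      for c and \<phi> :: "bfun \<Rightarrow> bfun"
    define well where "well c \<longleftrightarrow> (\<forall>f\<in>set xs. case c f of (g, p, q) \<Rightarrow>
        p \<in> base n \<union> set xs \<and> q \<in> base n \<union> set xs \<and> f = gate_fun n g p q)" for c
    have "\<exists>c. well c \<and> (\<forall>\<phi>. eqs c \<phi> \<longrightarrow> (\<forall>f\<in>set xs. \<phi> f = f))"
      unfolding eqs_def well_def by (rule chain_equations[OF xs(3)])
    then obtain c where c: "well c" "\<And>\<phi>. eqs c \<phi> \<Longrightarrow> \<forall>f\<in>set xs. \<phi> f = f" by blast
    have c1: "p \<in> base n \<union> set xs" "q \<in> base n \<union> set xs" "f = gate_fun n g p q"
      if "f \<in> set xs" "c f = (g, p, q)" for f g p q
      using bspec[OF c(1)[unfolded well_def] that(1)] unfolding that(2) by auto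
    define num where "num ys p = (SOME a. a < length ys \<and> ys ! a = p)" for ys and p :: bfun
    have num: "num ys p < length ys \<and> ys ! num ys p = p" if "p \<in> set ys" for ys p
      unfolding num_def by (rule someI_ex) (use that in \<open>simp add: in_set_conv_nth\<close>)
    \<comment> \<open>A function that is both in the base and in the chain is numbered through the
      base, matching the case distinction in \<open>chain_equations\<close>.\<close>
    define idx where "idx p = (if p \<in> base n then num bs p else n + 1 + num xs p)" for p
    define d where "d = map (\<lambda>f. case c f of (g, p, q) \<Rightarrow> (g, idx p, idx q)) xs"
    have idx: "idx p < n + 1 + k" if "p \<in> base n \<union> set xs" for p
    proof (cases "p \<in> base n")
      case True
      then show ?thesis using num[of p bs] bs by (simp add: idx_def)
    next
      case False
      then have "num xs p < k" using that num[of p xs] xs(2) by simp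
      with False show ?thesis by (simp add: idx_def)
    qed
    have val: "(bs @ zs) ! idx p = (if p \<in> base n then p else zs ! num xs p)" for zs p
    proof (cases "p \<in> base n")
      case True
      then show ?thesis using num[of p bs] bs by (simp add: idx_def nth_append)
    next
      case False
      then show ?thesis using bs by (simp add: idx_def nth_append)
    qed
    have d_nth: "d ! i = (g, idx p, idx q)" if "i < k" "c (xs ! i) = (g, p, q)" for i g p q
      using that xs(2) by (simp add: d_def)
    have "set d \<subseteq> UNIV \<times> {..<n + 1 + k} \<times> {..<n + 1 + k}"
    proof
      fix e assume "e \<in> set d"
      then obtain f where f: "f \<in> set xs" "e = (case c f of (g, p, q) \<Rightarrow> (g, idx p, idx q))"
        by (auto simp: d_def)
      obtain g p q where gpq: "c f = (g, p, q)" by (cases "c f")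
      show "e \<in> UNIV \<times> {..<n + 1 + k} \<times> {..<n + 1 + k}"
        using idx[OF c1(1)[OF f(1) gpq]] idx[OF c1(2)[OF f(1) gpq]] by (simp add: f(2) gpq)
    qed
    then have "d \<in> D" unfolding D_def using xs(2) by (simp add: d_def)
    moreover have "case d ! i of (g, a, b) \<Rightarrow> xs ! i = gate_fun n g ((bs @ xs) ! a) ((bs @ xs) ! b)"
      if i: "i < k" for i
    proof -
      obtain g p q where gpq: "c (xs ! i) = (g, p, q)" by (cases "c (xs ! i)")
      have f: "xs ! i \<in> set xs" using i xs(2) by simp
      have "(bs @ xs) ! idx p = p" if "p \<in> base n \<union> set xs" for p
        unfolding val using that num[of p xs] by auto
      with c1[OF f gpq] show ?thesis by (simp add: d_nth[OF i gpq])
    qed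
    then have "solves d xs" using xs(2) by (simp add: solves_def)
    moreover have "zs = xs" if zs: "solves d zs" for zs
    proof -
      have numxs: "num xs (xs ! i) = i" if "i < k" for i
        using num[of "xs ! i" xs] that xs(1,2) by (metis nth_eq_iff_index_eq nth_mem)
      \<comment> \<open>A second solution \<open>zs\<close> of the same description, read as a map
        on functions through the numbering \<open>xs\<close>, satisfies the chain equations and is
        therefore the identity.\<close>
      have "eqs c (\<lambda>f. zs ! num xs f)"
        unfolding eqs_def
      proof
        fix f assume "f \<in> set xs"
        then obtain i where i: "i < k" "f = xs ! i" using xs(2) by (metis in_set_conv_nth)
        obtain g p q where gpq: "c (xs ! i) = (g, p, q)" by (cases "c (xs ! i)")
        have "case d ! i of (g, a, b) \<Rightarrow> zs ! i = gate_fun n g ((bs @ zs) ! a) ((bs @ zs) ! b)"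
          by (rule zs[unfolded solves_def, THEN conjunct2, rule_format, OF i(1)])
        then show "case c f of (g, p, q) \<Rightarrow> zs ! num xs f = gate_fun n g
            (if p \<in> base n then p else zs ! num xs p) (if q \<in> base n then q else zs ! num xs q)"
          unfolding d_nth[OF i(1) gpq] i(2) gpq numxs[OF i(1)] val prod.case .
      qed
      then have "\<forall>f\<in>set xs. zs ! num xs f = f" by (rule c(2))
      then have "zs ! i = xs ! i" if "i < k" for i
        using numxs[OF that] xs(2) that by (metis nth_mem)
      then show ?thesis using zs xs(2) unfolding solves_def by (intro nth_equalityI) simp_all
    qed
    ultimately show ?thesis by blast
  qed
  then obtain d where d: "\<And>xs. xs \<in> X \<Longrightarrow> d xs \<in> D \<and> solves (d xs) xs \<and> (\<forall>zs. solves (d xs) zs \<longrightarrow> zs = xs)"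
    by metis
  have "inj_on d X"
    by (rule inj_onI) (metis d)
  have card_gates: "CARD(bool \<Rightarrow> bool \<Rightarrow> bool) = 16" by (simp add: card_fun)
  have fin: "finite (UNIV \<times> {..<n + 1 + k} \<times> {..<n + 1 + k} :: ((bool \<Rightarrow> bool \<Rightarrow> bool) \<times> nat \<times> nat) set)"
    by simp
  have "finite D" unfolding D_def by (rule finite_lists_length_eq[OF fin])
  with \<open>inj_on d X\<close> have "card X \<le> card D" using d by (metis card_inj_on_le image_subsetI)
  also have "\<dots> = (16 * (n + 1 + k)\<^sup>2) ^ k"
    unfolding D_def card_lists_length_eq[OF fin] card_cartesian_product card_gates card_lessThan
    by (simp only: power2_eq_square)
  finally show ?thesis by (simp add: X_def)
qed

lemma finite_numberings: "finite S \<Longrightarrow> finite {xs. distinct xs \<and> set xs = S}"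
  by (rule finite_subset[OF _ finite_subset_distinct]) auto

lemma card_numberings: "finite S \<Longrightarrow> card {xs. distinct xs \<and> set xs = S} = fact (card S)"
proof -
  assume S: "finite S"
  have "{xs. distinct xs \<and> set xs = S} = {xs. length xs = card S \<and> distinct xs \<and> set xs \<subseteq> S}"
    using S by (auto simp: distinct_card) (metis card_subset_eq distinct_card subsetD)
  then show ?thesis using card_lists_distinct_length_eq[OF S order_refl] by (simp add: fact_prod)
qed

definition chain_sets :: "nat \<Rightarrow> nat \<Rightarrow> bfun set set" where
  "chain_sets n k = {S. chain n S \<and> card S = k}"

lemma finite_bfuns: "finite {f :: bfun. \<forall>u. f u \<longrightarrow> length u = n}"
proof -
  have "{f :: bfun. \<forall>u. f u \<longrightarrow> length u = n} \<subseteq> (\<lambda>S u. u \<in> S) ` Pow {u. length u = n}"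
    by (auto intro!: image_eqI[of _ _ "Collect _"])
  moreover have "finite {u :: bool list. length u = n}" using finite_lists_length_eq[of "UNIV :: bool set" n] by simp
  ultimately show ?thesis by (meson finite_Pow_iff finite_imageI finite_subset)
qed

lemma finite_chains: "finite (chain_sets n k)"
proof -
  have "S \<subseteq> {f. \<forall>u. f u \<longrightarrow> length u = n}" if "chain n S" for S
    using that by (induction rule: chain.induct) (auto simp: gate_fun_def)
  then have "chain_sets n k \<subseteq> Pow {f. \<forall>u. f u \<longrightarrow> length u = n}" by (auto simp: chain_sets_def)
  then show ?thesis using finite_bfuns by (meson finite_Pow_iff finite_subset)
qed

text \<open>Different sets have disjoint collections of numberings, so
  \<open>card_chain_numberings\<close> counts each chain \<open>k!\<close> times.\<close>

lemma card_chains: "card (chain_sets n k) * fact k \<le> (16 * (n + 1 + k)\<^sup>2) ^ k"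
proof -
  have "card (\<Union>S\<in>chain_sets n k. {xs. distinct xs \<and> set xs = S}) = (\<Sum>S\<in>chain_sets n k. card {xs. distinct xs \<and> set xs = S})"
    by (intro card_UN_disjoint finite_chains) (auto simp: chain_sets_def intro!: finite_numberings finite_chain)
  also have "\<dots> = (\<Sum>S\<in>chain_sets n k. fact k)"
    by (intro sum.cong refl) (auto simp: chain_sets_def card_numberings finite_chain)
  also have "(\<Union>S\<in>chain_sets n k. {xs. distinct xs \<and> set xs = S}) =
      {xs. distinct xs \<and> length xs = k \<and> chain n (set xs)}"
    by (auto simp: chain_sets_def distinct_card)
  finally show ?thesis using card_chain_numberings[of k n] by simp
qed

section \<open>Encoding circuits\<close>

text \<open>\<open>m\<close> is the number of wires so far; the newest one, \<open>m - 1\<close>,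
  has distance 0.\<close>

fun encode_gate :: "nat \<Rightarrow> gate \<Rightarrow> bool list" where
  "encode_gate m (g, a, b) =
     replicate (m - 1 - a) True @ False # replicate (m - 1 - b) True @
     [False, g False False, g False True, g True False, g True True]"

fun encode :: "nat \<Rightarrow> gate list \<Rightarrow> bool list" where
  "encode m [] = []"
| "encode m (e # gs) = encode_gate m e @ encode (Suc m) gs"

definition eval_gates :: "gate list \<Rightarrow> bool list \<Rightarrow> bool list" where
  "eval_gates gs x = foldl (\<lambda>vs (g, a, b). vs @ [g (vs ! a) (vs ! b)]) x gs"

lemma length_eval_gates: "length (eval_gates gs x) = length x + length gs"
  unfolding eval_gates_def by (induction gs arbitrary: x) (auto split: prod.split)

lemma eval_gates_append_nth:
  assumes "i < length x + length gs"
  shows "eval_gates (gs @ hs) x ! i = eval_gates gs x ! i"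
proof -
  have "eval_gates hs vs ! i = vs ! i" if "i < length vs" for vs
    using that unfolding eval_gates_def
    by (induction hs arbitrary: vs) (auto simp: nth_append split: prod.split)
  then show ?thesis using assms length_eval_gates[of gs x] by (simp add: eval_gates_def)
qed

lemma pointer_replicate: "pointer (replicate k True @ False # r) = k"
  "after_pointer (replicate k True @ False # r) = r"
  by (induction k) (auto simp: pointer_def after_pointer_def)

lemma after_gate_encode: "after_gate (encode_gate m e @ r) = r"
  by (cases e) (simp add: after_gate_def pointer_replicate)

lemma gate_value_encode:
  assumes "a < length vs" "b < length vs"
  shows "gate_value (encode_gate (length vs) (g, a, b) @ r) (rev vs) = g (vs ! a) (vs ! b)"
proof -
  have "wire (rev vs) (length vs - 1 - a) = vs ! a" if "a < length vs" for a
    using that by (auto simp: wire_def rev_nth)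
  then show ?thesis using assms
    by (cases "vs ! a"; cases "vs ! b")
      (simp_all add: gate_value_def pointer_replicate, simp_all add: wire_def)
qed

lemma encode_gate_nonempty: "encode_gate m e \<noteq> []"
  by (cases e) simp

lemma gates_encode: "gates (encode m gs) = length gs"
  by (induction m gs rule: encode.induct)
    (simp_all add: gates.simps encode_gate_nonempty after_gate_encode)

lemma evaluate_encode:
  assumes "\<forall>i<length gs. case gs ! i of (g, a, b) \<Rightarrow> a < length vs + i \<and> b < length vs + i"
  shows "evaluate (encode (length vs) gs) (rev vs) = rev (eval_gates gs vs)"
  using assms
proof (induction gs arbitrary: vs)
  case Nil
  show ?case by (simp add: evaluate.simps eval_gates_def)
next
  case (Cons e gs)
  obtain g a b where e: "e = (g, a, b)" by (cases e)
  have ab: "a < length vs" "b < length vs" using Cons.prems[rule_format, of 0] e by auto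
  let ?vs = "vs @ [g (vs ! a) (vs ! b)]"
  have "case gs ! i of (g, a, b) \<Rightarrow> a < length ?vs + i \<and> b < length ?vs + i" if "i < length gs" for i
    using Cons.prems[rule_format, of "Suc i"] that by simp
  then have "evaluate (encode (length ?vs) gs) (rev ?vs) = rev (eval_gates gs ?vs)"
    using Cons.IH[of ?vs] by blast
  moreover have "gate_value (encode (length vs) (e # gs)) (rev vs) = g (vs ! a) (vs ! b)"
    using gate_value_encode[OF ab] e by simp
  moreover have "after_gate (encode (length vs) (e # gs)) = encode (length ?vs) gs"
    by (simp add: after_gate_encode)
  moreover have "encode (length vs) (e # gs) \<noteq> []" by (simp add: encode_gate_nonempty)
  ultimately show ?case
    by (subst evaluate.simps) (simp add: eval_gates_def e del: encode.simps)
qed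

lemma length_encode: "length (encode m gs) \<le> length gs * (2 * (m + length gs) + 6)"
proof (induction m gs rule: encode.induct)
  case (2 m e gs)
  have "length (encode_gate m e) \<le> 2 * m + 6" by (cases e) simp
  with 2 show ?case by (simp add: algebra_simps)
qed simp

text \<open>The verifier outputs the newest wire. So the circuit is cut after its output gate or, if
  the output is an input wire, replaced by a single projection gate; this accounts for
  \<open>max 1\<close>.\<close>

lemma circuit_encoding:
  assumes "is_circuit n C"
  obtains y where "gates y \<le> max 1 (num_gates C)"
    "length y \<le> gates y * (2 * (n + gates y) + 6)"
    "\<And>u. length u = n \<Longrightarrow> circuit_output y u = circuit_value C u"
proof -
  obtain gs out where C: "C = (gs, out)" by force
  have ok: "\<forall>i<length gs. case gs ! i of (g, a, b) \<Rightarrow> a < n + i \<and> b < n + i" "out < n + length gs"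
    using assms by (auto simp: C is_circuit_def)
  define hs where "hs = (if n \<le> out then take (out - n + 1) gs else [(\<lambda>a b. a, out, out)])"
  have len: "length hs \<le> max 1 (length gs)" "hs \<noteq> []"
    using ok(2) by (auto simp: hs_def)
  have valid: "\<forall>i<length hs. case hs ! i of (g, a, b) \<Rightarrow> a < n + i \<and> b < n + i"
    using ok by (auto simp: hs_def)
  have "circuit_output (encode n hs) u = circuit_value C u" if u: "length u = n" for u
  proof -
    have "evaluate (encode n hs) (rev u) = rev (eval_gates hs u)"
      using evaluate_encode[of hs u] valid u by simp
    then have "circuit_output (encode n hs) u = eval_gates hs u ! (n + length hs - 1)"
      using len(2) u by (simp add: circuit_output_def wire_def length_eval_gates rev_nth)
    also have "\<dots> = eval_gates gs u ! out"
    proof (cases "n \<le> out")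
      case True
      then have "n + length hs - 1 = out" using ok(2) by (auto simp: hs_def)
      moreover have "eval_gates (hs @ drop (out - n + 1) gs) u ! out = eval_gates hs u ! out"
        by (rule eval_gates_append_nth) (use True ok(2) u in \<open>auto simp: hs_def\<close>)
      ultimately show ?thesis using True by (simp add: hs_def)
    next
      case False
      then have "eval_gates ([] @ gs) u ! out = eval_gates [] u ! out"
        using u by (intro eval_gates_append_nth) simp
      then show ?thesis using False u by (simp add: hs_def eval_gates_def nth_append)
    qed
    finally show ?thesis by (simp add: C circuit_value_def eval_gates_def)
  qed
  then show thesis
    using that[of "encode n hs"] len(1) length_encode[of n hs] by (simp add: gates_encode num_gates_def C)
qed

section \<open>The counting bound\<close>

text \<open>\<open>j^k / k!\<close> is one term of the exponential series at \<open>j\<close>, and e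
  < 4. This stands in for Stirling's formula.\<close>

lemma power_le_fact_mult: "j ^ k \<le> fact k * 4 ^ j" for j k :: nat
proof -
  have "real j ^ k / fact k \<le> exp (real j)"
  proof -
    have "(\<Sum>i\<in>{k}. real j ^ i /\<^sub>R fact i) \<le> (\<Sum>i. real j ^ i /\<^sub>R fact i)"
      by (rule sum_le_suminf[OF summable_exp_generic]) auto
    then show ?thesis by (simp add: exp_def divide_inverse mult.commute)
  qed
  also have "exp (real j) = exp 1 ^ j" by (simp flip: exp_of_nat_mult)
  also have "\<dots> \<le> 4 ^ j" using exp_le by (intro power_mono) auto
  finally have "real (j ^ k) \<le> real (fact k * 4 ^ j)" by (simp add: field_simps)
  then show ?thesis by (simp only: of_nat_le_iff)
qed

definition total_length :: "nat \<Rightarrow> nat" where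
  "total_length k = (\<Sum>i<k. length (std_enum i))"

lemma cost_eq: "cost k = 2 * total_length k + 40 * k"
  by (simp add: cost_def total_length_def sum.distrib sum_distrib_left)

lemma cost_mono: "i \<le> j \<Longrightarrow> cost i \<le> cost j"
  unfolding cost_def by (intro sum_mono2) auto

lemma fact_le_total_length: "fact k \<le> (2::nat) ^ (total_length k + k)"
proof (induction k)
  case (Suc k)
  have "Suc k \<le> 2 ^ Suc (length (std_enum k))" using length_std_enum[of k] by simp
  then have "Suc k * fact k \<le> 2 ^ Suc (length (std_enum k)) * 2 ^ (total_length k + k)"
    using Suc by (rule mult_le_mono)
  then show ?case by (simp add: total_length_def power_add mult_ac)
qed simp

text \<open>With \<open>j = n + 1 + k\<close>, two uses of \<open>power_le_fact_mult\<close> produce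
  \<open>(k!)^2\<close>, of which \<open>card_chains\<close> cancels one factor. The exponent
  collects \<open>4 k\<close> from \<open>16^k\<close>, \<open>total_length k + k\<close> from
  \<open>k!\<close>, \<open>4 j\<close> from the powers of 4, and \<open>j\<close> from the left
  factor, which bounds the choices of an output function.\<close>

lemma card_chains_le: "(n + 1 + k) * card (chain_sets n k) \<le> 2 ^ (total_length k + 10 * k + 5 * (n + 1))"
proof -
  define j where "j = n + 1 + k"
  have "card (chain_sets n k) * fact k \<le> 16 ^ k * (j ^ k * j ^ k)"
    using card_chains[of n k, folded j_def] by (simp only: power_mult_distrib power2_eq_square)
  also have "\<dots> \<le> 16 ^ k * ((fact k * 4 ^ j) * (fact k * 4 ^ j))"
    by (intro mult_le_mono power_le_fact_mult order_refl)
  finally have "card (chain_sets n k) * fact k \<le> (16 ^ k * fact k * 4 ^ j * 4 ^ j) * fact k"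
    by (simp only: mult_ac)
  then have "card (chain_sets n k) \<le> 16 ^ k * fact k * 4 ^ j * 4 ^ j" by simp
  also have "\<dots> \<le> 16 ^ k * 2 ^ (total_length k + k) * 4 ^ j * 4 ^ j"
    by (intro mult_le_mono fact_le_total_length order_refl)
  also have "\<dots> = 2 ^ (4 * k) * 2 ^ (total_length k + k) * 2 ^ (2 * j) * 2 ^ (2 * j)"
    by (simp add: power_mult)
  finally have "j * card (chain_sets n k) \<le>
      2 ^ j * (2 ^ (4 * k) * 2 ^ (total_length k + k) * 2 ^ (2 * j) * 2 ^ (2 * j))"
    by (intro mult_le_mono) (simp_all add: less_imp_le)
  also have "\<dots> = 2 ^ (total_length k + 10 * k + 5 * (n + 1))"
    unfolding power_add[symmetric] j_def by (rule arg_cong[where f = "power 2"]) simp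
  finally show ?thesis by (simp add: j_def)
qed

text \<open>Halved, the constant 40 of \<open>cost\<close> gives \<open>20 k\<close>:
  \<open>10 k\<close> covers the exponent of \<open>card_chains_le\<close>, and for
  \<open>k >= n + 1\<close> the other \<open>10 k\<close> covers its \<open>5 (n + 1)\<close> and
  the saving of \<open>5 (n + 1)\<close>. For smaller \<open>k\<close> everything is quadratic in
  \<open>n\<close>.\<close>

lemma card_chains_le_of_cost:
  assumes "cost k < 2 ^ Suc n" "(n + 1) * (n + 1) + 20 * (n + 1) \<le> 2 ^ n"
  shows "(n + 1 + k) * card (chain_sets n k) \<le> 2 ^ (2 ^ n - 5 * (n + 1))"
proof -
  have "total_length k + 10 * k + 5 * (n + 1) \<le> 2 ^ n - 5 * (n + 1)"
  proof (cases "n + 1 \<le> k")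
    case True
    have "total_length k + 20 * k < 2 ^ n" using assms(1) by (simp add: cost_eq)
    with True show ?thesis by simp
  next
    case False
    have "total_length k \<le> (\<Sum>i<k. k)"
      unfolding total_length_def
      by (intro sum_mono) (auto intro: order_trans[OF length_std_enum_le])
    also have "\<dots> \<le> (n + 1) * (n + 1)" using False by (simp del: mult_Suc mult_Suc_right) (intro mult_le_mono; simp)
    finally have "total_length k \<le> (n + 1) * (n + 1)" .
    moreover have "10 * k + 10 * (n + 1) \<le> 20 * (n + 1)" using False by simp
    ultimately have "total_length k + (10 * k + 10 * (n + 1)) \<le> 2 ^ n"
      using assms(2) by (meson add_mono order_trans)
    then show ?thesis by linarith
  qed
  then show ?thesis using card_chains_le[of n k] by (meson one_le_numeral order_trans power_increasing)
qed

definition chain_funs :: "nat \<Rightarrow> bfun set" where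
  "chain_funs n = (\<Union>k\<in>{k. cost k < 2 ^ Suc n - 1}. \<Union>S\<in>chain_sets n k. base n \<union> S)"

text \<open>The union over fewer than \<open>2^(n+1)\<close> values of \<open>k\<close> uses up one
  of the five saved \<open>n + 1\<close>.\<close>

lemma card_chain_funs:
  assumes "(n + 1) * (n + 1) + 20 * (n + 1) \<le> 2 ^ n"
  shows "finite (chain_funs n)" "card (chain_funs n) \<le> 2 ^ (2 ^ n - 4 * (n + 1))"
proof -
  let ?K = "{k. cost k < 2 ^ Suc n - 1}"
  have sub: "?K \<subseteq> {..<2 ^ Suc n}" by (auto simp: cost_eq)
  then have fin: "finite ?K" by (rule finite_subset) simp
  have finS: "finite (base n \<union> S)" if "S \<in> chain_sets n k" for S k
    using that by (auto simp: chain_sets_def base_def finite_chain)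
  show "finite (chain_funs n)" unfolding chain_funs_def
    using fin finite_chains finS by blast
  have "card (\<Union>S\<in>chain_sets n k. base n \<union> S) \<le> 2 ^ (2 ^ n - 5 * (n + 1))" if "k \<in> ?K" for k
  proof -
    have "card (\<Union>S\<in>chain_sets n k. base n \<union> S) \<le> (\<Sum>S\<in>chain_sets n k. card (base n \<union> S))"
      by (rule card_UN_le) (rule finite_chains)
    also have "\<dots> \<le> (\<Sum>S\<in>chain_sets n k. n + 1 + k)"
    proof (rule sum_mono)
      fix S assume "S \<in> chain_sets n k"
      moreover have "card (base n) \<le> n + 1" using card_length[of "base_list n"] by (simp add: base_def base_list_def)
      ultimately show "card (base n \<union> S) \<le> n + 1 + k"
        using card_Un_le[of "base n" S] by (simp add: chain_sets_def)
    qed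
    also have "\<dots> = (n + 1 + k) * card (chain_sets n k)" by simp
    also have "\<dots> \<le> 2 ^ (2 ^ n - 5 * (n + 1))"
      using that assms by (intro card_chains_le_of_cost) auto
    finally show ?thesis .
  qed
  then have "card (chain_funs n) \<le> (\<Sum>k\<in>?K. 2 ^ (2 ^ n - 5 * (n + 1)))"
    unfolding chain_funs_def by (intro order_trans[OF card_UN_le[OF fin]] sum_mono)
  also have "\<dots> \<le> 2 ^ Suc n * 2 ^ (2 ^ n - 5 * (n + 1))"
    using card_mono[OF _ sub] by simp
  also have "\<dots> = 2 ^ (2 ^ n - 4 * (n + 1))"
    unfolding power_add[symmetric] using assms by (intro arg_cong[where f = "power 2"]) simp
  finally show "card (chain_funs n) \<le> 2 ^ (2 ^ n - 4 * (n + 1))" .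
qed

section \<open>The set in NP and the size of its slices\<close>

definition certificate_bound :: "nat poly" where
  "certificate_bound = [:0, 6, 4:]"

definition easy_strings :: "bool list set" where
  "easy_strings = {x. \<exists>y. length y \<le> poly certificate_bound (length x) \<and> accepts x y}"

lemma easy_strings_NP: "easy_strings \<in> NP"
  unfolding NP_def easy_strings_def using polytime_accepts by blast

lemma length_easy_strings: "x \<in> easy_strings \<Longrightarrow> \<exists>n. length x = 2 ^ Suc n - 1"
  by (auto simp: easy_strings_def accepts_iff)

text \<open>The first \<open>2^n - 1\<close> symbols are free, and the remaining \<open>2^n\<close>
  are the truth table of a member of \<open>chain_funs n\<close>.\<close>

lemma card_slice_easy_strings:
  assumes "(n + 1) * (n + 1) + 20 * (n + 1) \<le> 2 ^ n"
  shows "card (slice easy_strings (2 ^ Suc n - 1)) \<le> 2 ^ (2 ^ Suc n - 1 - 4 * (n + 1))"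
proof -
  let ?N = "2 ^ Suc n - 1 :: nat" and ?M = "2 ^ n - 1 :: nat"
  define glue where "glue = (\<lambda>(p, h :: bfun). p @ map (\<lambda>j. h (std_enum j)) [?M..<?N])"
  have "slice easy_strings ?N \<subseteq> glue ` ({p. length p = ?M} \<times> chain_funs n)"
  proof
    fix x assume "x \<in> slice easy_strings ?N"
    then obtain y where x: "length x = ?N" and y: "accepts x y"
      by (auto simp: slice_def easy_strings_def)
    then obtain n' where n': "?N = 2 ^ Suc n' - 1" "cost (gates y) < ?N"
      "\<And>j. j < ?N \<Longrightarrow> length (std_enum j) = n' \<Longrightarrow> circuit_output y (std_enum j) = x ! j"
      by (auto simp: accepts_iff)
    have "(2::nat) ^ Suc n = 2 ^ Suc n'" using n'(1) by (metis Suc_pred' diff_Suc_1 pos2 zero_less_power One_nat_def)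
    then have nn: "n' = n" by simp
    obtain S h where S: "chain n S" "card S \<le> gates y" "h \<in> base n \<union> S"
      "\<And>u. length u = n \<Longrightarrow> circuit_output y u = h u"
      using circuit_output_chain[of n y] by blast
    have "cost (card S) < ?N" using cost_mono[OF S(2)] n'(2) by simp
    then have "h \<in> chain_funs n" unfolding chain_funs_def using S by (auto simp: chain_sets_def)
    moreover have "x = glue (take ?M x, h)"
    proof (rule nth_equalityI)
      have "?M \<le> ?N" by (intro diff_le_mono power_increasing) auto
      then show len: "length x = length (glue (take ?M x, h))" using x by (simp add: glue_def)
      fix j assume j: "j < length x"
      show "x ! j = glue (take ?M x, h) ! j"
      proof (cases "j < ?M")
        case True
        then show ?thesis using j by (simp add: glue_def nth_append)
      next
        case False
        then have "length (std_enum j) = n" using j x by (subst length_std_enum_eq_iff) auto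
        then have "x ! j = h (std_enum j)" using n'(3)[of j] S(4)[of "std_enum j"] j x nn by simp
        then show ?thesis using False j x \<open>?M \<le> ?N\<close> by (simp add: glue_def nth_append)
      qed
    qed
    ultimately show "x \<in> glue ` ({p. length p = ?M} \<times> chain_funs n)"
      using x by (intro image_eqI[of _ _ "(take ?M x, h)"]) auto
  qed
  moreover have L: "finite {p :: bool list. length p = ?M}" "card {p :: bool list. length p = ?M} = 2 ^ ?M"
    using finite_lists_length_eq[of "UNIV :: bool set" ?M] card_lists_length_eq[of "UNIV :: bool set" ?M]
    by simp_all
  ultimately have "card (slice easy_strings ?N) \<le> card ({p :: bool list. length p = ?M} \<times> chain_funs n)"
    using card_chain_funs(1)[OF assms] by (meson card_image_le card_mono finite_SigmaI finite_imageI order_trans)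
  also have "\<dots> \<le> 2 ^ ?M * 2 ^ (2 ^ n - 4 * (n + 1))"
    unfolding card_cartesian_product L(2) using card_chain_funs(2)[OF assms] by simp
  also have "\<dots> = 2 ^ (?N - 4 * (n + 1))"
    unfolding power_add[symmetric] using assms by (intro arg_cong[where f = "power 2"]) simp
  finally show ?thesis .
qed

lemma square_le_power2: "10 \<le> n \<Longrightarrow> (n + 1) * (n + 1) + 20 * (n + 1) \<le> (2::nat) ^ n"
  by (induction n rule: dec_induct) auto

lemma slice_easy_strings_small:
  "\<forall>\<^sub>F N in sequentially. slice easy_strings N = {} \<or>
     log 2 (real (card (slice easy_strings N))) < real N - real (twice_log N)"
  unfolding eventually_sequentially
proof (intro exI[of _ "2 ^ 11"] allI impI)
  fix N :: nat
  assume N: "2 ^ 11 \<le> N"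
  show "slice easy_strings N = {} \<or>
     log 2 (real (card (slice easy_strings N))) < real N - real (twice_log N)"
  proof (cases "slice easy_strings N = {}")
    case False
    then obtain n where n: "N = 2 ^ Suc n - 1"
      using length_easy_strings by (auto simp: slice_def)
    have "2 ^ 11 \<le> (2::nat) ^ Suc n - 1" using N n by (simp only:)
    also have "\<dots> < 2 ^ Suc n" by simp
    finally have "2 ^ 11 < (2::nat) ^ Suc n" .
    then have n10: "10 < n" unfolding power2_less_iff by simp
    have sq: "(n + 1) * (n + 1) + 20 * (n + 1) \<le> 2 ^ n" using n10 by (intro square_le_power2) simp
    have "(2::nat) ^ Suc n \<ge> 1" by simp
    then have "2 ^ Suc n \<le> Suc N \<and> Suc N < 2 ^ Suc (Suc n)" unfolding n power_Suc by linarith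
    then have f: "twice_log N = 2 * (n + 2)"
      unfolding twice_log_def using length_std_enum_eq_iff[of N "Suc n"] by simp
    have "card (slice easy_strings N) \<le> 2 ^ (N - 4 * (n + 1))"
      using card_slice_easy_strings[OF sq] n by simp
    then have "real (card (slice easy_strings N)) \<le> 2 ^ (N - 4 * (n + 1))"
      by (metis of_nat_le_iff of_nat_numeral of_nat_power)
    moreover have "0 < card (slice easy_strings N)"
    proof -
      have "finite (slice easy_strings N)"
        using finite_lists_length_eq[of "UNIV :: bool set" N]
        by (rule rev_finite_subset) (auto simp: slice_def)
      then show ?thesis using False by (simp add: card_gt_0_iff)
    qed
    ultimately have "log 2 (real (card (slice easy_strings N))) \<le> log 2 (2 ^ (N - 4 * (n + 1)))"
      by (intro log_mono) auto
    also have "\<dots> = real (N - 4 * (n + 1))" by (simp add: log_nat_power)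
    also have "\<dots> < real N - real (twice_log N)"
    proof -
      have "4 * (n + 1) \<le> N" using sq unfolding n power_Suc by linarith
      then show ?thesis using n10 by (simp add: f of_nat_diff)
    qed
    finally show ?thesis ..
  qed simp
qed

section \<open>Measure zero\<close>

lemma twice_log_bound: "2 powr (- real (twice_log n)) \<le> 1 / (real n + 1)\<^sup>2"
proof -
  define k where "k = Suc (length (std_enum n))"
  have "Suc n \<le> 2 ^ k" using length_std_enum[of n] by (simp add: k_def)
  then have "real (Suc n) \<le> 2 ^ k" by (metis of_nat_le_iff of_nat_numeral of_nat_power)
  then have "(real n + 1)\<^sup>2 \<le> (2 ^ k)\<^sup>2" by (intro power_mono) auto
  also have "(2 ^ k)\<^sup>2 = (2::real) powr real (twice_log n)"
    unfolding twice_log_def k_def[symmetric] by (simp only: powr_realpow zero_less_numeral power_mult[symmetric] mult.commute)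
  finally show ?thesis
    unfolding powr_minus_divide by (intro divide_left_mono) auto
qed

text \<open>Since \<open>1/(r+1)^2 <= 1/r - 1/(r+1)\<close>, the tail from \<open>m\<close>
  telescopes to at most \<open>1/m\<close>, and \<open>m = 2^i\<close> is the required
  modulus.\<close>

lemma p_convergent_twice_log: "p_convergent (\<lambda>n. 2 powr (- real (twice_log n)))"
proof -
  let ?a = "\<lambda>n. 2 powr (- real (twice_log n))"
  have tele: "(\<lambda>n. 1 / real (n + m) - 1 / real (Suc n + m)) sums (1 / real (0 + m))" for m
  proof -
    have "(\<lambda>n. 1 / real (n + m)) \<longlonglongrightarrow> 0"
      using LIMSEQ_ignore_initial_segment[OF lim_1_over_n, of m] by simp
    then show ?thesis using telescope_sums'[of "\<lambda>n. 1 / real (n + m)" 0] by simp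
  qed
  have le: "?a (n + m) \<le> 1 / real (n + m) - 1 / real (Suc n + m)" if "0 < m" for n m
  proof -
    define r where "r = real (n + m)"
    have r: "0 < r" using that by (simp add: r_def)
    have "?a (n + m) \<le> 1 / (r + 1)\<^sup>2" using twice_log_bound[of "n + m"] by (simp add: r_def)
    also have "\<dots> \<le> 1 / (r * (r + 1))"
    proof (intro divide_left_mono mult_pos_pos zero_less_power)
      show "r * (r + 1) \<le> (r + 1)\<^sup>2" using r by (simp add: power2_eq_square)
    qed (use r in auto)
    also have "\<dots> = 1 / r - 1 / (r + 1)" using r by (simp add: field_simps)
    finally show ?thesis by (simp add: r_def add_ac)
  qed
  have summable: "summable (\<lambda>n. ?a (n + m))" if "0 < m" for m
    by (rule summable_comparison_test_ev[OF _ sums_summable[OF tele[of m]]])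
      (use le[OF that] in \<open>simp add: eventually_sequentially\<close>)
  have "(\<Sum>n. ?a (n + 2 ^ i)) \<le> 1 / 2 ^ i" for i
  proof -
    have "(\<Sum>n. ?a (n + 2 ^ i)) \<le> (\<Sum>n. 1 / real (n + 2 ^ i) - 1 / real (Suc n + 2 ^ i))"
      by (intro suminf_le le summable sums_summable[OF tele]) auto
    also have "\<dots> = 1 / 2 ^ i" using sums_unique[OF tele[of "2 ^ i"]] by simp
    finally show ?thesis .
  qed
  moreover have "summable ?a" using summable[of 1] summable_Suc_iff[of ?a] by simp
  ultimately show ?thesis unfolding p_convergent_def using polytime_nat_power2 by auto
qed

section \<open>From the size bound to the cost bound\<close>

lemma cost_le_log:
  assumes "0 < k"
  shows "real (cost k) \<le> real k * (2 * log 2 (real k) + 40)"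
proof -
  have "real (length (std_enum i)) \<le> log 2 (real k)" if "i < k" for i
  proof -
    have "2 ^ length (std_enum i) \<le> k" using length_std_enum[of i] that by linarith
    then have "2 ^ length (std_enum i) \<le> real k" by (metis of_nat_le_iff of_nat_numeral of_nat_power)
    then show ?thesis using assms by (simp add: le_log_iff powr_realpow)
  qed
  then have "(\<Sum>i<k. 2 * real (length (std_enum i)) + 40) \<le> (\<Sum>i<k. 2 * log 2 (real k) + 40)"
    by (intro sum_mono) auto
  then show ?thesis by (simp add: cost_def)
qed

text \<open>With L = log n, the size bound gives log k <= n + 1 - L, since 1 + \<alpha> L/n <= 2. So
  2 log k + 40 <= 2 (n + 21 - L), and the cost is at most 2^(n+1) (1 + \<alpha> L/n) (1 + (21 -
  L)/n). Now L >= 21 makes the term with 1/n^2 nonpositive, and (1 - \<alpha>) L >= 22 leaves at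
  most -1/n from the linear one. This gains 2^(n+1)/n > 1, enough for the final -1.\<close>

lemma cost_lt_of_size_le:
  fixes \<alpha> :: real
  assumes \<alpha>: "0 \<le> \<alpha>" "\<alpha> < 1"
    and L: "21 \<le> log 2 (real n)" "22 / (1 - \<alpha>) \<le> log 2 (real n)"
    and k: "real k \<le> 2 ^ n / real n * (1 + \<alpha> * log 2 (real n) / real n)"
  shows "cost k < 2 ^ Suc n - 1"
proof (cases "k = 0")
  case True
  have "(2::nat) \<le> 2 ^ Suc n" by simp
  then show ?thesis using True unfolding cost_def by (simp only: lessThan_0 sum.empty)
next
  case False
  define L where "L = log 2 (real n)"
  have n: "0 < n" using L by (cases "n = 0") (auto simp: log_def)
  have "real n < 2 ^ n" using less_exp[of n] by (metis of_nat_less_iff of_nat_numeral of_nat_power)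
  then have "L \<le> n" using n by (simp add: L_def log_le_iff powr_realpow)
  have aL: "\<alpha> * L \<le> L" using \<alpha> L by (intro mult_left_le_one_le) (auto simp: L_def)
  have "\<alpha> * L / n \<le> 1" using aL \<open>L \<le> n\<close> n by simp
  have s: "real k \<le> 2 ^ n / n * (1 + \<alpha> * L / n)" using k by (simp add: L_def)
  also have "\<dots> \<le> 2 ^ n / n * 2" using \<open>\<alpha> * L / n \<le> 1\<close> by (intro mult_left_mono) auto
  finally have "log 2 k \<le> log 2 (2 ^ n / n * 2)" using False by (intro log_mono) auto
  also have "\<dots> = n + 1 - L" using n by (simp add: L_def log_mult log_divide log_nat_power)
  finally have logk: "log 2 k \<le> n + 1 - L" .
  have "real (cost k) \<le> real k * (2 * log 2 k + 40)" using False by (intro cost_le_log) simp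
  also have "\<dots> \<le> (2 ^ n / n * (1 + \<alpha> * L / n)) * (2 * (n + 1 - L) + 40)"
    using s logk \<open>L \<le> n\<close> \<alpha> L False by (intro mult_mono) (auto simp: L_def)
  also have "\<dots> = 2 ^ Suc n * ((1 + \<alpha> * L / n) * (1 + (21 - L) / n))"
    using n by (simp add: field_simps)
  also have "\<dots> \<le> 2 ^ Suc n * (1 - 1 / n)"
  proof (intro mult_left_mono)
    have "22 \<le> (1 - \<alpha>) * L" using L(2) \<alpha> by (simp add: L_def field_simps)
    then have 1: "(21 - (1 - \<alpha>) * L) / n \<le> (- 1) / n" using n by (intro divide_right_mono) auto
    have "\<alpha> * L * (21 - L) \<le> 0"
      using \<alpha> L by (intro mult_nonneg_nonpos) (auto simp: L_def)
    then have 2: "\<alpha> * L * (21 - L) / (n * n) \<le> 0" by (simp add: divide_nonpos_nonneg)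
    have "(1 + \<alpha> * L / n) * (1 + (21 - L) / n) =
        1 + (21 - (1 - \<alpha>) * L) / n + \<alpha> * L * (21 - L) / (n * n)"
      using n by (simp add: field_simps)
    then show "(1 + \<alpha> * L / n) * (1 + (21 - L) / n) \<le> 1 - 1 / n" using 1 2 by simp
  qed simp
  also have "\<dots> < 2 ^ Suc n - 1"
  proof -
    have "real n < 2 ^ Suc n" using \<open>real n < 2 ^ n\<close> unfolding power_Suc by linarith
    then have "1 < 2 ^ Suc n / real n" using n by (subst less_divide_eq_1_pos) simp_all
    then show ?thesis by (simp add: right_diff_distrib)
  qed
  finally have "real (cost k) < real (2 ^ Suc n - 1)" by (simp add: of_nat_diff)
  then show ?thesis by (simp only: of_nat_less_iff)
qed

lemma prefix_in_easy_strings: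
  assumes C: "is_circuit n C" "\<And>x. length x = n \<Longrightarrow> circuit_value C x \<longleftrightarrow> x \<in> slice B n"
    and cost: "cost (max 1 (num_gates C)) < 2 ^ Suc n - 1"
  shows "seq_prefix (char_seq B) (2 ^ Suc n - 1) \<in> easy_strings"
proof -
  let ?N = "2 ^ Suc n - 1 :: nat"
  let ?x = "seq_prefix (char_seq B) ?N"
  obtain y where y: "gates y \<le> max 1 (num_gates C)" "length y \<le> gates y * (2 * (n + gates y) + 6)"
    "\<And>u. length u = n \<Longrightarrow> circuit_output y u = circuit_value C u"
    using circuit_encoding[OF C(1)] by blast
  have lt: "cost (gates y) < ?N" using cost_mono[OF y(1)] cost by simp
  then have "gates y \<le> ?N" by (simp add: cost_eq)
  moreover have "n \<le> ?N" using less_exp[of n] unfolding power_Suc by linarith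
  \<comment> \<open>Bounding both \<open>n\<close> and the number of gates by the string length
    turns the length of the encoding into \<open>certificate_bound\<close>.\<close>
  ultimately have "gates y * (2 * (n + gates y) + 6) \<le> ?N * (2 * (?N + ?N) + 6)"
    by (intro mult_le_mono add_mono order_refl)
  also have "a * (2 * (a + a) + 6) = poly certificate_bound a" for a
    by (simp add: certificate_bound_def algebra_simps)
  finally have "length y \<le> poly certificate_bound (length ?x)" using y(2) by (simp add: seq_prefix_def)
  moreover have "accepts ?x y"
    unfolding accepts_iff using lt y(3) C(2)
    by (auto simp: seq_prefix_def char_seq_def slice_def intro!: exI[of _ n])
  ultimately show ?thesis by (auto simp: easy_strings_def)
qed

theorem mainTheorem1:
  fixes \<alpha> :: real
  assumes "\<alpha> < 1"
  shows "M_measure_zero NP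
    (char_seq ` SIZE_io (\<lambda>n. 2 ^ n / real n * (1 + \<alpha> * log 2 (real n) / real n)))"
proof -
  define s where "s = (\<lambda>n. 2 ^ n / real n * (1 + \<alpha> * log 2 (real n) / real n))"
  \<comment> \<open>The estimate needs a nonnegative coefficient; raising a negative \<alpha> to 0
    only enlarges the class.\<close>
  define \<beta> where "\<beta> = max \<alpha> 0"
  define c where "c = max 21 (22 / (1 - \<beta>))"
  have \<beta>: "0 \<le> \<beta>" "\<beta> < 1" "\<alpha> \<le> \<beta>" using assms by (auto simp: \<beta>_def)
  have "char_seq B \<in> infinitely_often easy_strings" if B: "B \<in> SIZE_io s" for B
    unfolding infinitely_often_def mem_Collect_eq INFM_nat
  proof
    fix m :: nat
    \<comment> \<open>Makes \<open>n > m'\<close> imply both \<open>n > m\<close> and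
      \<open>log 2 n >= c\<close>.\<close>
    define m' where "m' = max m (nat \<lceil>2 powr c\<rceil>)"
    obtain n C where n: "m' < n" and C: "is_circuit n C" "real (num_gates C) \<le> s n"
      "\<And>x. length x = n \<Longrightarrow> circuit_value C x \<longleftrightarrow> x \<in> slice B n"
      using B unfolding SIZE_io_def mem_Collect_eq INFM_nat by blast
    have "2 powr c \<le> real n" using n unfolding m'_def by linarith
    moreover have "0 < n" using n by simp
    ultimately have "c \<le> log 2 (real n)" by (simp add: le_log_iff)
    then have L: "21 \<le> log 2 (real n)" "22 / (1 - \<beta>) \<le> log 2 (real n)" by (simp_all add: c_def)
    have "s n \<le> 2 ^ n / real n * (1 + \<beta> * log 2 (real n) / real n)"
      unfolding s_def using \<beta>(3) L(1)
      by (intro mult_left_mono add_left_mono divide_right_mono mult_right_mono) auto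
    \<comment> \<open>Needed because the encoding spends one gate even on a circuit without
      gates.\<close>
    moreover have "1 \<le> 2 ^ n / real n * (1 + \<beta> * log 2 (real n) / real n)"
    proof -
      have "real n < 2 ^ n" using less_exp[of n] by (metis of_nat_less_iff of_nat_numeral of_nat_power)
      then have "1 * 1 \<le> 2 ^ n / real n * (1 + \<beta> * log 2 (real n) / real n)"
        using \<beta>(1) L(1) \<open>0 < n\<close> by (intro mult_mono) auto
      then show ?thesis by simp
    qed
    ultimately have "real (max 1 (num_gates C)) \<le> 2 ^ n / real n * (1 + \<beta> * log 2 (real n) / real n)"
      using C(2) by (simp add: of_nat_max)
    then have "cost (max 1 (num_gates C)) < 2 ^ Suc n - 1"
      using \<beta> L by (intro cost_lt_of_size_le) auto
    then have "seq_prefix (char_seq B) (2 ^ Suc n - 1) \<in> easy_strings"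
      using C by (intro prefix_in_easy_strings) auto
    moreover have "m < 2 ^ Suc n - 1"
      using less_exp[of n] n unfolding m'_def power_Suc by linarith
    ultimately show "\<exists>N>m. seq_prefix (char_seq B) N \<in> easy_strings" by blast
  qed
  then have "char_seq ` SIZE_io s \<subseteq> infinitely_often easy_strings" by blast
  then show ?thesis
    unfolding M_measure_zero_def s_def[symmetric]
    using easy_strings_NP polytime_nat_twice_log slice_easy_strings_small p_convergent_twice_log
    by blast
qed

end
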